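(* For $p\in[2,\infty)$, both $\mathrm{FBL}^{(p)}[JT_*]$ and $\mathrm{FBL}^{(p)}[JT^*]$ fail the $\lambda$-Fatou property, for every $\lambda>0$; also, both $\overline{I}_{w^*}^{p}[JT_*]$ and $\overline{I}_{w^*}^{p}[JT^*]$ fail to be monotonically bounded.
   Context: All Banach spaces are real. James Tree space: index nodes by $(n,i)$, $n\ge0$, $1\le i\le2^n$, arranged as a binary tree in which $(n+1,2i-1)$ and $(n+1,2i)$ are the direct descendants of $(n,i)$. A segment is a finite set of nodes $\{(n,i_n),(n+1,i_{n+1}),\dots,(m,i_m)\}$ in which each node is a direct descendant of the previous one. $JT$ is the completion of the finitely supported families $a=(a_{ni})$ under $\|a\|=\big(\sup\sum_k|\sum_{(n,i)\in S_k}a_{ni}|^2\big)^{1/2}$, the supremum over all finite collections of pairwise disjoint segments $(S_k)$. The canonical unit vectors $(e^*_{ni})$ form a boundedly complete basis of $JT$; let $(e_{ni})\subset JT^*$ be the biorthogonal functionals. $JT_*$ is the closed linear span of $(e_{ni})$ in $JT^*$; it is a predual of $JT$. $JT^*$ is the dual of $JT$. Let $1/p+1/p'=1$. For $z_1,\dots,z_n$ in a Banach space, $\|(z_i)_{i=1}^n\|_{p,\mathrm{weak}}=\sup\{\|\sum_i\alpha_i z_i\| : \|(\alpha_i)_i\|_{\ell_{p'}}\le 1\}$. For a Banach space $X$, $H_{w^*}[X]$ is the vector lattice (pointwise operations and order) of positively homogeneous functions $f:X^*\to\mathbb R$ that are weak$^*$-continuous on bounded sets. For $f\in H_{w^*}[X]$,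 $\|f\|_p$ is the infimum of all $C\ge 0$ such that $(\sum_{i=1}^n|f(x_i^* )|^p)^{1/p}\le C\|(x_i^* )_{i=1}^n\|_{p,\mathrm{weak}}$ for all $n$ and all $x_1^*,\dots,x_n^*\in X^*$. $H_{w^*}^p[X]=\{f\in H_{w^*}[X]:\|f\|_p<\infty\}$, normed by $\|\cdot\|_p$. For $x\in X$, $\delta_x(x^* )=\langle x^*,x\rangle$. $\mathrm{FVL}[X]$ is the vector sublattice of $H_{w^*}[X]$ generated by $\{\delta_x:x\in X\}$; $\mathrm{FBL}^{(p)}[X]$ is the closure of $\mathrm{FVL}[X]$ in $H_{w^*}^p[X]$; $I_{w^*}[X]$ is the (order) ideal of $H_{w^*}[X]$ generated by $\{\delta_x:x\in X\}$; $\overline{I}_{w^*}^p[X]$ is the closure of $I_{w^*}[X]$ in $H_{w^*}^p[X]$. A Banach lattice $Z$ has the $\lambda$-Fatou property if for every upward directed set $\mathcal S\subset Z_+$ having a supremum $z_0$ in $Z$, one has $\|z_0\|\le\lambda\sup_{z\in\mathcal S}\|z\|$. $Z$ is monotonically bounded if every norm-bounded increasing net in $Z_+$ has an upper bound in $Z$. *)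

theory Defs
  imports "HOL-Analysis.Analysis"
begin

section \<open>The James Tree space\<close>

definition tree_nodes :: "(nat \<times> nat) set" where
  "tree_nodes = {(n, i). 1 \<le> i \<and> i \<le> 2 ^ n}"

definition direct_descendant :: "nat \<times> nat \<Rightarrow> nat \<times> nat \<Rightarrow> bool" where
  "direct_descendant w v \<longleftrightarrow>
     fst w = fst v + 1 \<and> (snd w = 2 * snd v - 1 \<or> snd w = 2 * snd v)"

definition tree_segment :: "(nat \<times> nat) set \<Rightarrow> bool" where
  "tree_segment S \<longleftrightarrow> (\<exists>n m i. n \<le> m \<and> S = (\<lambda>k. (k, i k)) ` {n..m} \<and> S \<subseteq> tree_nodes \<and>
     (\<forall>k\<in>{n..<m}. direct_descendant (k + 1, i (k + 1)) (k, i k)))"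

definition segment_family :: "(nat \<times> nat) set set \<Rightarrow> bool" where
  "segment_family \<S> \<longleftrightarrow> finite \<S> \<and> (\<forall>S\<in>\<S>. tree_segment S) \<and> pairwise disjnt \<S>"

definition jt_values :: "(nat \<times> nat \<Rightarrow> real) \<Rightarrow> real set" where
  "jt_values a = {(\<Sum>S\<in>\<S>. \<bar>\<Sum>v\<in>S. a v\<bar>\<^sup>2) | \<S>. segment_family \<S>}"

definition jt_nrm :: "(nat \<times> nat \<Rightarrow> real) \<Rightarrow> real" where
  "jt_nrm a = sqrt (Sup (jt_values a))"

definition fin_family :: "(nat \<times> nat \<Rightarrow> real) \<Rightarrow> bool" where
  "fin_family a \<longleftrightarrow> finite {v. a v \<noteq> 0} \<and> {v. a v \<noteq> 0} \<subseteq> tree_nodes"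

text \<open>
  The completion of the finitely supported families is realised inside the space of all families
  of finite norm, as the set of norm limits of finitely supported families. That this is a
  completion is the \<^class>\<open>banach\<close> instance below; density of the finitely supported
  families is part of the definition.
\<close>

definition jt_families :: "(nat \<times> nat \<Rightarrow> real) set" where
  "jt_families = {a. (\<forall>v. v \<notin> tree_nodes \<longrightarrow> a v = 0) \<and> bdd_above (jt_values a) \<and>
     (\<forall>\<epsilon>>0. \<exists>b. fin_family b \<and> jt_nrm (\<lambda>v. a v - b v) < \<epsilon>)}"

lemma segment_family_empty: "segment_family {}"
  by (simp add: segment_family_def)

lemma tree_segment_singleton:
  assumes "v \<in> tree_nodes" shows "tree_segment {v}"
  unfolding tree_segment_def
  by (rule exI[of _ "fst v"], rule exI[of _ "fst v"], rule exI[of _ "\<lambda>_. snd v"])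
    (use assms in auto)

lemma segment_family_singleton:
  assumes "v \<in> tree_nodes" shows "segment_family {{v}}"
  using tree_segment_singleton[OF assms] by (simp add: segment_family_def)

lemma jt_nrm_upper:
  assumes "bdd_above (jt_values a)" "segment_family \<S>"
  shows "L2_set (\<lambda>S. sum a S) \<S> \<le> jt_nrm a"
proof -
  have "(\<Sum>S\<in>\<S>. \<bar>\<Sum>v\<in>S. a v\<bar>\<^sup>2) \<in> jt_values a"
    using assms(2) by (auto simp: jt_values_def)
  from cSup_upper[OF this assms(1)] show ?thesis
    by (simp add: L2_set_def jt_nrm_def)
qed

lemma jt_nrm_least:
  assumes "\<And>\<S>. segment_family \<S> \<Longrightarrow> L2_set (\<lambda>S. sum a S) \<S> \<le> C"
  shows "bdd_above (jt_values a)" "jt_nrm a \<le> C"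
proof -
  have C: "0 \<le> C" using assms[OF segment_family_empty] by simp
  have le: "x \<le> C\<^sup>2" if x: "x \<in> jt_values a" for x
  proof -
    obtain \<S> where \<S>: "segment_family \<S>" "x = (\<Sum>S\<in>\<S>. (\<Sum>v\<in>S. a v)\<^sup>2)"
      using x unfolding jt_values_def power2_abs by blast
    have "sqrt x \<le> C" using assms[OF \<S>(1)] \<S>(2) by (simp add: L2_set_def)
    thus ?thesis using C by (metis real_sqrt_le_iff real_sqrt_abs abs_of_nonneg)
  qed
  show "bdd_above (jt_values a)" using le unfolding bdd_above_def by blast
  have "jt_values a \<noteq> {}" using segment_family_empty by (auto simp: jt_values_def)
  hence "Sup (jt_values a) \<le> C\<^sup>2" using le by (rule cSup_least)
  thus "jt_nrm a \<le> C" unfolding jt_nrm_def using C real_le_lsqrt by blast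
qed

lemma jt_nrm_ge_0:
  assumes "bdd_above (jt_values a)" shows "0 \<le> jt_nrm a"
  using jt_nrm_upper[OF assms segment_family_empty] by simp

lemma jt_nrm_coord:
  assumes "bdd_above (jt_values a)" "v \<in> tree_nodes" shows "\<bar>a v\<bar> \<le> jt_nrm a"
  using jt_nrm_upper[OF assms(1) segment_family_singleton[OF assms(2)]] by simp

lemma jt_nrm_triangle:
  assumes "bdd_above (jt_values a)" "bdd_above (jt_values b)"
  shows "bdd_above (jt_values (\<lambda>v. a v + b v))" "jt_nrm (\<lambda>v. a v + b v) \<le> jt_nrm a + jt_nrm b"
proof -
  have "L2_set (\<lambda>S. sum (\<lambda>v. a v + b v) S) \<S> \<le> jt_nrm a + jt_nrm b"
    if "segment_family \<S>" for \<S>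
  proof -
    have "L2_set (\<lambda>S. sum (\<lambda>v. a v + b v) S) \<S> \<le>
        L2_set (\<lambda>S. sum a S) \<S> + L2_set (\<lambda>S. sum b S) \<S>"
      by (simp add: sum.distrib L2_set_triangle_ineq)
    also have "\<dots> \<le> jt_nrm a + jt_nrm b"
      using jt_nrm_upper[OF assms(1) that] jt_nrm_upper[OF assms(2) that] by simp
    finally show ?thesis .
  qed
  from jt_nrm_least[OF this]
  show "bdd_above (jt_values (\<lambda>v. a v + b v))" "jt_nrm (\<lambda>v. a v + b v) \<le> jt_nrm a + jt_nrm b"
    by auto
qed

lemma jt_nrm_scale_le:
  assumes "bdd_above (jt_values a)"
  shows "bdd_above (jt_values (\<lambda>v. c * a v))" "jt_nrm (\<lambda>v. c * a v) \<le> \<bar>c\<bar> * jt_nrm a"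
proof -
  have "L2_set (\<lambda>S. sum (\<lambda>v. c * a v) S) \<S> \<le> \<bar>c\<bar> * jt_nrm a" if "segment_family \<S>" for \<S>
  proof -
    have "L2_set (\<lambda>S. sum (\<lambda>v. c * a v) S) \<S> = \<bar>c\<bar> * L2_set (\<lambda>S. sum a S) \<S>"
      by (simp add: L2_set_def sum_distrib_left[symmetric] power_mult_distrib real_sqrt_mult)
    thus ?thesis using jt_nrm_upper[OF assms that] by (simp add: mult_left_mono)
  qed
  from jt_nrm_least[OF this]
  show "bdd_above (jt_values (\<lambda>v. c * a v))" "jt_nrm (\<lambda>v. c * a v) \<le> \<bar>c\<bar> * jt_nrm a"
    by auto
qed

lemma jt_nrm_scale:
  assumes "bdd_above (jt_values a)"
  shows "jt_nrm (\<lambda>v. c * a v) = \<bar>c\<bar> * jt_nrm a"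
proof (cases "c = 0")
  case True
  thus ?thesis
    using jt_nrm_scale_le[OF assms, of c] jt_nrm_ge_0[of "\<lambda>v. c * a v"] by simp
next
  case False
  have "jt_nrm a \<le> \<bar>inverse c\<bar> * jt_nrm (\<lambda>v. c * a v)"
    using jt_nrm_scale_le(2)[OF jt_nrm_scale_le(1)[OF assms, of c], of "inverse c"] False
    by (simp add: mult.assoc[symmetric])
  hence "\<bar>c\<bar> * jt_nrm a \<le> jt_nrm (\<lambda>v. c * a v)"
    using False by (simp add: field_simps abs_inverse)
  thus ?thesis using jt_nrm_scale_le(2)[OF assms, of c] by simp
qed

lemma jt_nrm_diff:
  assumes "bdd_above (jt_values a)" "bdd_above (jt_values b)"
  shows "bdd_above (jt_values (\<lambda>v. a v - b v))" "jt_nrm (\<lambda>v. a v - b v) \<le> jt_nrm a + jt_nrm b"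
  using jt_nrm_triangle[OF assms(1) jt_nrm_scale_le(1)[OF assms(2), of "-1"]]
    jt_nrm_scale_le(2)[OF assms(2), of "-1"] by auto

lemma bdd_above_jt_values_fin_family:
  assumes "fin_family b" shows "bdd_above (jt_values b)"
proof -
  let ?T = "{v. b v \<noteq> 0}"
  have fin: "finite ?T" using assms by (simp add: fin_family_def)
  have "L2_set (\<lambda>S. sum b S) \<S> \<le> (\<Sum>v\<in>?T. \<bar>b v\<bar>)" if "segment_family \<S>" for \<S>
  proof -
    have finS: "\<forall>S\<in>\<S>. finite S" and fin\<S>: "finite \<S>"
      using that by (auto simp: segment_family_def tree_segment_def)
    have disj: "\<forall>A\<in>\<S>. \<forall>B\<in>\<S>. A \<noteq> B \<longrightarrow> A \<inter> B = {}"
      using that by (auto simp: segment_family_def pairwise_def disjnt_def)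
    have "L2_set (\<lambda>S. sum b S) \<S> \<le> (\<Sum>S\<in>\<S>. \<bar>sum b S\<bar>)" by (rule L2_set_le_sum_abs)
    also have "\<dots> \<le> (\<Sum>S\<in>\<S>. \<Sum>v\<in>S. \<bar>b v\<bar>)" by (intro sum_mono sum_abs)
    also have "\<dots> = (\<Sum>v\<in>\<Union>\<S>. \<bar>b v\<bar>)"
      using sum.Union_disjoint[OF finS disj, of "\<lambda>v. \<bar>b v\<bar>"] by (simp add: comp_def)
    also have "\<dots> = (\<Sum>v\<in>\<Union>\<S> \<inter> ?T. \<bar>b v\<bar>)"
      using finS fin\<S> by (intro sum.mono_neutral_right) auto
    also have "\<dots> \<le> (\<Sum>v\<in>?T. \<bar>b v\<bar>)" using fin by (intro sum_mono2) auto
    finally show ?thesis .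
  qed
  thus ?thesis by (rule jt_nrm_least(1))
qed

lemma fin_family_add:
  assumes "fin_family a" "fin_family b" shows "fin_family (\<lambda>v. a v + b v)"
proof -
  have "{v. a v + b v \<noteq> 0} \<subseteq> {v. a v \<noteq> 0} \<union> {v. b v \<noteq> 0}" by auto
  thus ?thesis using assms finite_subset unfolding fin_family_def by blast
qed

lemma fin_family_scale:
  assumes "fin_family a" shows "fin_family (\<lambda>v. c * a v)"
proof -
  have "{v. c * a v \<noteq> 0} \<subseteq> {v. a v \<noteq> 0}" by auto
  thus ?thesis using assms finite_subset unfolding fin_family_def by blast
qed

lemma fin_family_jt_families:
  assumes "fin_family a" shows "a \<in> jt_families"
proof -
  have "jt_nrm (\<lambda>v. 0) = 0"
    using jt_nrm_scale[OF bdd_above_jt_values_fin_family[OF assms], of 0] by simp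
  hence "\<forall>\<epsilon>>0. \<exists>b. fin_family b \<and> jt_nrm (\<lambda>v. a v - b v) < \<epsilon>"
    using assms by (intro allI impI exI[of _ a]) simp
  thus ?thesis
    using assms bdd_above_jt_values_fin_family[OF assms]
    by (auto simp: jt_families_def fin_family_def)
qed

lemma zero_jt_families: "(\<lambda>_. 0) \<in> jt_families"
  by (rule fin_family_jt_families) (simp add: fin_family_def)

lemma add_jt_families:
  assumes a: "a \<in> jt_families" and b: "b \<in> jt_families"
  shows "(\<lambda>v. a v + b v) \<in> jt_families"
proof -
  have "\<exists>c. fin_family c \<and> jt_nrm (\<lambda>v. (a v + b v) - c v) < \<epsilon>" if "\<epsilon> > 0" for \<epsilon>
  proof -
    have "\<epsilon> / 2 > 0" using that by simp
    then obtain a' b' where *: "fin_family a'" "jt_nrm (\<lambda>v. a v - a' v) < \<epsilon> / 2"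
      "fin_family b'" "jt_nrm (\<lambda>v. b v - b' v) < \<epsilon> / 2"
      using a b unfolding jt_families_def by blast
    have "bdd_above (jt_values (\<lambda>v. a v - a' v))" "bdd_above (jt_values (\<lambda>v. b v - b' v))"
      using a b * by (auto simp: jt_families_def intro: jt_nrm_diff(1) bdd_above_jt_values_fin_family)
    from jt_nrm_triangle(2)[OF this] *
    have "jt_nrm (\<lambda>v. (a v + b v) - (a' v + b' v)) < \<epsilon>" by (simp add: algebra_simps)
    thus ?thesis using fin_family_add[OF *(1,3)] by blast
  qed
  thus ?thesis using a b jt_nrm_triangle(1) by (auto simp: jt_families_def)
qed

lemma scale_jt_families:
  assumes a: "a \<in> jt_families" shows "(\<lambda>v. c * a v) \<in> jt_families"
proof -
  have "\<exists>b. fin_family b \<and> jt_nrm (\<lambda>v. c * a v - b v) < \<epsilon>" if "\<epsilon> > 0" for \<epsilon>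
  proof -
    have "\<epsilon> / (\<bar>c\<bar> + 1) > 0" using that by (simp add: add_nonneg_pos)
    then obtain b where b: "fin_family b" "jt_nrm (\<lambda>v. a v - b v) < \<epsilon> / (\<bar>c\<bar> + 1)"
      using a unfolding jt_families_def by blast
    have bd: "bdd_above (jt_values (\<lambda>v. a v - b v))"
      using a b by (auto simp: jt_families_def intro: jt_nrm_diff(1) bdd_above_jt_values_fin_family)
    have "jt_nrm (\<lambda>v. c * (a v - b v)) \<le> (\<bar>c\<bar> + 1) * jt_nrm (\<lambda>v. a v - b v)"
      using jt_nrm_scale[OF bd, of c] jt_nrm_ge_0[OF bd] by (simp add: algebra_simps)
    also have "\<dots> < \<epsilon>" using b(2) by (simp add: field_simps add_nonneg_pos)
    finally have "jt_nrm (\<lambda>v. c * a v - c * b v) < \<epsilon>" by (simp add: algebra_simps)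
    thus ?thesis using fin_family_scale[OF b(1)] by blast
  qed
  thus ?thesis using a jt_nrm_scale_le(1) by (auto simp: jt_families_def)
qed

lemma uminus_jt_families: "a \<in> jt_families \<Longrightarrow> (\<lambda>v. - a v) \<in> jt_families"
  using scale_jt_families[of a "-1"] by simp

lemma diff_jt_families:
  "a \<in> jt_families \<Longrightarrow> b \<in> jt_families \<Longrightarrow> (\<lambda>v. a v - b v) \<in> jt_families"
  using add_jt_families[of a "\<lambda>v. - b v"] uminus_jt_families[of b] by simp

typedef jt = jt_families
  morphisms jt_apply Abs_jt
  using zero_jt_families by blast

setup_lifting type_definition_jt

instantiation jt :: real_vector
begin

lift_definition zero_jt :: jt is "\<lambda>_. 0" by (rule zero_jt_families)
lift_definition plus_jt :: "jt \<Rightarrow> jt \<Rightarrow> jt" is "\<lambda>a b v. a v + b v" by (rule add_jt_families)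
lift_definition uminus_jt :: "jt \<Rightarrow> jt" is "\<lambda>a v. - a v" by (rule uminus_jt_families)
lift_definition minus_jt :: "jt \<Rightarrow> jt \<Rightarrow> jt" is "\<lambda>a b v. a v - b v" by (rule diff_jt_families)
lift_definition scaleR_jt :: "real \<Rightarrow> jt \<Rightarrow> jt" is "\<lambda>c a v. c * a v" by (rule scale_jt_families)

instance
  by standard (transfer, simp add: algebra_simps)+

end

instantiation jt :: real_normed_vector
begin

lift_definition norm_jt :: "jt \<Rightarrow> real" is jt_nrm .

lemma abs_jt_apply_le: "\<bar>jt_apply a v\<bar> \<le> norm a"
proof (cases "v \<in> tree_nodes")
  case True
  thus ?thesis by transfer (auto simp: jt_families_def intro: jt_nrm_coord)
next
  case False
  have "jt_apply a v = 0" using False by transfer (auto simp: jt_families_def)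
  moreover have "0 \<le> norm a" by transfer (auto simp: jt_families_def intro: jt_nrm_ge_0)
  ultimately show ?thesis by simp
qed

definition sgn_jt :: "jt \<Rightarrow> jt" where "sgn_jt a = a /\<^sub>R norm a"
definition dist_jt :: "jt \<Rightarrow> jt \<Rightarrow> real" where "dist_jt a b = norm (a - b)"
definition uniformity_jt :: "(jt \<times> jt) filter" where
  "uniformity_jt = (INF e\<in>{0<..}. principal {(x, y). dist x y < e})"
definition open_jt :: "jt set \<Rightarrow> bool" where
  "open_jt U \<longleftrightarrow> (\<forall>x\<in>U. \<forall>\<^sub>F (x', y) in uniformity. x' = x \<longrightarrow> y \<in> U)"

instance
proof
  fix a b :: jt and c :: real
  show "(norm a = 0) = (a = 0)"
  proof
    assume "norm a = 0"
    thus "a = 0"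
      using abs_jt_apply_le[of a] by (simp add: jt_apply_inject[symmetric] zero_jt.rep_eq fun_eq_iff)
  next
    assume "a = 0"
    moreover have "jt_nrm (\<lambda>_. 0) = 0"
      using jt_nrm_scale[of "\<lambda>_. 0" 0] zero_jt_families by (auto simp: jt_families_def)
    ultimately show "norm a = 0" by (simp add: norm_jt.rep_eq zero_jt.rep_eq)
  qed
  show "norm (a + b) \<le> norm a + norm b"
    by transfer (auto simp: jt_families_def intro: jt_nrm_triangle)
  show "norm (c *\<^sub>R a) = \<bar>c\<bar> * norm a"
    by transfer (auto simp: jt_families_def intro: jt_nrm_scale)
qed (simp_all add: sgn_jt_def dist_jt_def uniformity_jt_def open_jt_def)

end

instance jt :: banach
proof
  fix X :: "nat \<Rightarrow> jt"
  assume X: "Cauchy X"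
  define x where "x n = jt_apply (X n)" for n
  have nrm: "norm (X m - X n) = jt_nrm (\<lambda>v. x m v - x n v)" for m n
    by (simp add: norm_jt.rep_eq minus_jt.rep_eq x_def)
  have bdd: "bdd_above (jt_values (x n))" for n
    using jt_apply[of "X n"] by (auto simp: jt_families_def x_def)
  have "Cauchy (\<lambda>n. x n v)" for v
  proof (rule metric_CauchyI)
    fix e :: real assume "0 < e"
    then obtain M where M: "\<forall>m\<ge>M. \<forall>n\<ge>M. norm (X m - X n) < e"
      using X by (auto simp: Cauchy_def dist_norm)
    have "dist (x m v) (x n v) \<le> norm (X m - X n)" for m n
      using abs_jt_apply_le[of "X m - X n" v] by (simp add: dist_real_def minus_jt.rep_eq x_def)
    thus "\<exists>M. \<forall>m\<ge>M. \<forall>n\<ge>M. dist (x m v) (x n v) < e" using M by (meson le_less_trans)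
  qed
  hence conv: "convergent (\<lambda>n. x n v)" for v by (rule Cauchy_convergent)
  define y where "y v = lim (\<lambda>n. x n v)" for v
  have y: "(\<lambda>n. x n v) \<longlonglongrightarrow> y v" for v
    using conv[of v] by (simp add: convergent_LIMSEQ_iff y_def)
  have key: "\<exists>M. \<forall>m\<ge>M. bdd_above (jt_values (\<lambda>v. x m v - y v)) \<and> jt_nrm (\<lambda>v. x m v - y v) \<le> e"
    if e: "e > 0" for e
  proof -
    obtain M where M: "\<forall>m\<ge>M. \<forall>n\<ge>M. norm (X m - X n) < e"
      using X e by (auto simp: Cauchy_def dist_norm)
    have bound: "L2_set (\<lambda>S. sum (\<lambda>v. x m v - y v) S) \<S> \<le> e" if "m \<ge> M" "segment_family \<S>" for m \<S>
    proof (rule LIMSEQ_le_const2)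
      show "(\<lambda>n. L2_set (\<lambda>S. sum (\<lambda>v. x m v - x n v) S) \<S>) \<longlonglongrightarrow>
          L2_set (\<lambda>S. sum (\<lambda>v. x m v - y v) S) \<S>"
        unfolding L2_set_def by (intro tendsto_intros y)
      have "L2_set (\<lambda>S. sum (\<lambda>v. x m v - x n v) S) \<S> \<le> e" if "n \<ge> M" for n
      proof -
        have "L2_set (\<lambda>S. sum (\<lambda>v. x m v - x n v) S) \<S> \<le> jt_nrm (\<lambda>v. x m v - x n v)"
          by (rule jt_nrm_upper[OF jt_nrm_diff(1)[OF bdd bdd] \<open>segment_family \<S>\<close>])
        also have "\<dots> < e" using M \<open>m \<ge> M\<close> that by (simp add: nrm[symmetric])
        finally show ?thesis by simp
      qed
      thus "\<exists>N. \<forall>n\<ge>N. L2_set (\<lambda>S. sum (\<lambda>v. x m v - x n v) S) \<S> \<le> e" by blast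
    qed
    show ?thesis
    proof (intro exI[of _ M] allI impI conjI)
      fix m assume "M \<le> m"
      show "bdd_above (jt_values (\<lambda>v. x m v - y v))"
        by (rule jt_nrm_least(1)[OF bound[OF \<open>M \<le> m\<close>]])
      show "jt_nrm (\<lambda>v. x m v - y v) \<le> e"
        by (rule jt_nrm_least(2)[OF bound[OF \<open>M \<le> m\<close>]])
    qed
  qed
  have yfam: "y \<in> jt_families"
  proof -
    have "y v = 0" if "v \<notin> tree_nodes" for v
    proof -
      have "x n v = 0" for n
        using jt_apply[of "X n"] that unfolding jt_families_def x_def by blast
      thus ?thesis using y[of v] LIMSEQ_unique[OF y[of v], of 0] by simp
    qed
    moreover have "bdd_above (jt_values y)"
    proof -
      obtain m where "bdd_above (jt_values (\<lambda>v. x m v - y v))" using key[of 1] by auto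
      from jt_nrm_diff(1)[OF bdd[of m] this] show ?thesis by simp
    qed
    moreover have "\<exists>b. fin_family b \<and> jt_nrm (\<lambda>v. y v - b v) < e" if e: "e > 0" for e
    proof -
      obtain m where m: "bdd_above (jt_values (\<lambda>v. x m v - y v))" "jt_nrm (\<lambda>v. x m v - y v) \<le> e / 2"
        using key[of "e / 2"] e by auto
      obtain b where b: "fin_family b" "jt_nrm (\<lambda>v. x m v - b v) < e / 2"
        using jt_apply[of "X m"] half_gt_zero[OF e] unfolding jt_families_def x_def by blast
      have "jt_nrm (\<lambda>v. (x m v - b v) - (x m v - y v)) \<le>
          jt_nrm (\<lambda>v. x m v - b v) + jt_nrm (\<lambda>v. x m v - y v)"
        by (rule jt_nrm_diff(2)[OF jt_nrm_diff(1)[OF bdd bdd_above_jt_values_fin_family[OF b(1)]] m(1)])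
      thus ?thesis using m b by (intro exI[of _ b]) simp
    qed
    ultimately show ?thesis unfolding jt_families_def by blast
  qed
  have "X \<longlonglongrightarrow> Abs_jt y"
  proof (rule metric_LIMSEQ_I)
    fix e :: real assume "0 < e"
    then obtain M where M: "\<forall>m\<ge>M. jt_nrm (\<lambda>v. x m v - y v) \<le> e / 2"
      using key[of "e / 2"] by auto
    have d: "dist (X m) (Abs_jt y) = jt_nrm (\<lambda>v. x m v - y v)" for m
      by (simp add: dist_norm norm_jt.rep_eq minus_jt.rep_eq x_def Abs_jt_inverse[OF yfam])
    have "dist (X m) (Abs_jt y) < e" if "M \<le> m" for m
      using M[rule_format, OF that] \<open>0 < e\<close> d[of m] by linarith
    thus "\<exists>no. \<forall>n\<ge>no. dist (X n) (Abs_jt y) < e" by blast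
  qed
  thus "convergent X" by (auto simp: convergent_def)
qed


section \<open>The predual \<open>JT\<^sub>*\<close>\<close>

lift_definition jt_unit :: "nat \<times> nat \<Rightarrow> jt" is
  "\<lambda>w v. if v = w \<and> w \<in> tree_nodes then 1 else 0"
  by (rule fin_family_jt_families) (auto simp: fin_family_def)

lift_definition jt_coord :: "nat \<times> nat \<Rightarrow> jt \<Rightarrow>\<^sub>L real" is "\<lambda>v a. jt_apply a v"
  by (rule bounded_linear_intro[where K = 1])
    (auto simp: plus_jt.rep_eq scaleR_jt.rep_eq abs_jt_apply_le)

lemma jt_coord_unit:
  assumes "w \<in> tree_nodes"
  shows "blinfun_apply (jt_coord v) (jt_unit w) = (if v = w then 1 else 0)"
  using assms by (simp add: jt_coord.rep_eq jt_unit.rep_eq)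

typedef jt_predual = "closure (span (jt_coord ` tree_nodes))"
  morphisms jt_predual_functional Abs_jt_predual
  using closure_subset span_zero by blast

setup_lifting type_definition_jt_predual

lemma subspace_jt_predual: "subspace (closure (span (jt_coord ` tree_nodes)))"
proof (rule subspaceI)
  let ?L = "span (jt_coord ` tree_nodes)"
  show "0 \<in> closure ?L" using closure_subset span_zero by blast
  fix x y assume "x \<in> closure ?L" and "y \<in> closure ?L"
  then obtain f g where fg: "\<And>n. f n \<in> ?L" "f \<longlonglongrightarrow> x" "\<And>n. g n \<in> ?L" "g \<longlonglongrightarrow> y"
    unfolding closure_sequential by blast
  have "(\<lambda>n. f n + g n) \<longlonglongrightarrow> x + y" by (intro tendsto_intros fg)
  moreover have "f n + g n \<in> ?L" for n by (intro span_add fg)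
  ultimately show "x + y \<in> closure ?L" unfolding closure_sequential by (intro exI[of _ "\<lambda>n. f n + g n"]) simp
next
  let ?L = "span (jt_coord ` tree_nodes)"
  fix c x assume "x \<in> closure ?L"
  then obtain f where f: "\<And>n. f n \<in> ?L" "f \<longlonglongrightarrow> x" unfolding closure_sequential by blast
  have "(\<lambda>n. c *\<^sub>R f n) \<longlonglongrightarrow> c *\<^sub>R x" by (intro tendsto_intros f)
  moreover have "c *\<^sub>R f n \<in> ?L" for n by (intro span_scale f)
  ultimately show "c *\<^sub>R x \<in> closure ?L" unfolding closure_sequential by (intro exI[of _ "\<lambda>n. c *\<^sub>R f n"]) simp
qed

instantiation jt_predual :: real_vector
begin

lift_definition zero_jt_predual :: jt_predual is 0
  by (rule subspace_0[OF subspace_jt_predual])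
lift_definition plus_jt_predual :: "jt_predual \<Rightarrow> jt_predual \<Rightarrow> jt_predual" is "(+)"
  by (rule subspace_add[OF subspace_jt_predual])
lift_definition uminus_jt_predual :: "jt_predual \<Rightarrow> jt_predual" is uminus
  by (rule subspace_neg[OF subspace_jt_predual])
lift_definition minus_jt_predual :: "jt_predual \<Rightarrow> jt_predual \<Rightarrow> jt_predual" is "(-)"
  by (rule subspace_diff[OF subspace_jt_predual])
lift_definition scaleR_jt_predual :: "real \<Rightarrow> jt_predual \<Rightarrow> jt_predual" is scaleR
  by (rule subspace_scale[OF subspace_jt_predual])

instance
  by standard (transfer, simp add: algebra_simps)+

end

instantiation jt_predual :: real_normed_vector
begin

lift_definition norm_jt_predual :: "jt_predual \<Rightarrow> real" is norm .

definition sgn_jt_predual :: "jt_predual \<Rightarrow> jt_predual" where "sgn_jt_predual a = a /\<^sub>R norm a"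
definition dist_jt_predual :: "jt_predual \<Rightarrow> jt_predual \<Rightarrow> real" where
  "dist_jt_predual a b = norm (a - b)"
definition uniformity_jt_predual :: "(jt_predual \<times> jt_predual) filter" where
  "uniformity_jt_predual = (INF e\<in>{0<..}. principal {(x, y). dist x y < e})"
definition open_jt_predual :: "jt_predual set \<Rightarrow> bool" where
  "open_jt_predual U \<longleftrightarrow> (\<forall>x\<in>U. \<forall>\<^sub>F (x', y) in uniformity. x' = x \<longrightarrow> y \<in> U)"

instance
proof
  fix a b :: jt_predual
  show "norm (a + b) \<le> norm a + norm b" by transfer (rule norm_triangle_ineq)
qed (simp_all add: sgn_jt_predual_def dist_jt_predual_def uniformity_jt_predual_def
    open_jt_predual_def, (transfer, simp)+)

end

instance jt_predual :: banach
proof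
  fix X :: "nat \<Rightarrow> jt_predual"
  assume X: "Cauchy X"
  have dist: "dist a b = dist (jt_predual_functional a) (jt_predual_functional b)" for a b
    by (simp add: dist_norm norm_jt_predual.rep_eq minus_jt_predual.rep_eq)
  have "Cauchy (\<lambda>n. jt_predual_functional (X n))"
    using X by (simp add: Cauchy_def dist)
  then obtain y where y: "(\<lambda>n. jt_predual_functional (X n)) \<longlonglongrightarrow> y"
    using Cauchy_convergent convergent_def by blast
  have "y \<in> closure (span (jt_coord ` tree_nodes))"
    using closed_sequentially[OF closed_closure _ y] jt_predual_functional by blast
  hence "jt_predual_functional (Abs_jt_predual y) = y" by (rule Abs_jt_predual_inverse)
  hence "X \<longlonglongrightarrow> Abs_jt_predual y"
    using y by (simp add: tendsto_iff dist)
  thus "convergent X" by (auto simp: convergent_def)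
qed


section \<open>Free Banach lattices\<close>

text \<open>The dual of \<open>'x\<close> is the type \<open>'x \<Rightarrow>\<^sub>L real\<close>. Since the scalars are one-dimensional,
  \<^const>\<open>strong_operator_topology\<close> on it is the topology of pointwise convergence, i.e. the
  weak* topology.\<close>

abbreviation weak_star_topology :: "('x::banach \<Rightarrow>\<^sub>L real) topology" where
  "weak_star_topology \<equiv> strong_operator_topology"

definition positively_homogeneous :: "('a::real_vector \<Rightarrow> real) \<Rightarrow> bool" where
  "positively_homogeneous f \<longleftrightarrow> (\<forall>c x. c \<ge> 0 \<longrightarrow> f (c *\<^sub>R x) = c * f x)"

definition H_wstar :: "(('x::banach \<Rightarrow>\<^sub>L real) \<Rightarrow> real) set" where
  "H_wstar = {f. positively_homogeneous f \<and>
     (\<forall>B. bounded B \<longrightarrow> continuous_map (subtopology weak_star_topology B) euclideanreal f)}"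

definition conj_exponent :: "real \<Rightarrow> real" where
  "conj_exponent p = p / (p - 1)" \<comment> \<open>meaningful for \<open>p > 1\<close>, where \<open>1 / p + 1 / conj_exponent p = 1\<close>\<close>

definition lp_norm :: "real \<Rightarrow> nat \<Rightarrow> (nat \<Rightarrow> real) \<Rightarrow> real" where
  "lp_norm p n \<alpha> = (\<Sum>i<n. \<bar>\<alpha> i\<bar> powr p) powr (1 / p)"

definition weak_lp_norm :: "real \<Rightarrow> nat \<Rightarrow> (nat \<Rightarrow> 'a::real_normed_vector) \<Rightarrow> real" where
  "weak_lp_norm p n z =
     (SUP \<alpha>\<in>{\<alpha>. lp_norm (conj_exponent p) n \<alpha> \<le> 1}. norm (\<Sum>i<n. \<alpha> i *\<^sub>R z i))"

definition p_norm :: "real \<Rightarrow> (('x::banach \<Rightarrow>\<^sub>L real) \<Rightarrow> real) \<Rightarrow> ennreal" where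
  "p_norm p f = Inf {ennreal C | C. 0 \<le> C \<and>
     (\<forall>n. \<forall>x :: nat \<Rightarrow> 'x \<Rightarrow>\<^sub>L real. lp_norm p n (\<lambda>i. f (x i)) \<le> C * weak_lp_norm p n x)}"

definition Hp_wstar :: "real \<Rightarrow> (('x::banach \<Rightarrow>\<^sub>L real) \<Rightarrow> real) set" where
  "Hp_wstar p = {f \<in> H_wstar. p_norm p f < \<infinity>}"

definition Hp_closure ::
  "real \<Rightarrow> (('x::banach \<Rightarrow>\<^sub>L real) \<Rightarrow> real) set \<Rightarrow> (('x \<Rightarrow>\<^sub>L real) \<Rightarrow> real) set" where
  "Hp_closure p A = {f \<in> Hp_wstar p. \<forall>\<epsilon>>0. \<exists>g\<in>A \<inter> Hp_wstar p. p_norm p (\<lambda>x. f x - g x) < ennreal \<epsilon>}"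

definition eval_at :: "'x::banach \<Rightarrow> ('x \<Rightarrow>\<^sub>L real) \<Rightarrow> real" where
  "eval_at x = (\<lambda>x'. blinfun_apply x' x)"

definition fun_subspace :: "('a \<Rightarrow> real) set \<Rightarrow> bool" where
  "fun_subspace L \<longleftrightarrow> (\<lambda>_. 0) \<in> L \<and> (\<forall>f\<in>L. \<forall>g\<in>L. (\<lambda>x. f x + g x) \<in> L) \<and>
     (\<forall>c. \<forall>f\<in>L. (\<lambda>x. c * f x) \<in> L)"

definition vector_sublattice :: "('a \<Rightarrow> real) set \<Rightarrow> ('a \<Rightarrow> real) set \<Rightarrow> bool" where
  "vector_sublattice E L \<longleftrightarrow> L \<subseteq> E \<and> fun_subspace L \<and> (\<forall>f\<in>L. \<forall>g\<in>L. sup f g \<in> L \<and> inf f g \<in> L)"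

definition order_ideal :: "('a \<Rightarrow> real) set \<Rightarrow> ('a \<Rightarrow> real) set \<Rightarrow> bool" where
  "order_ideal E I \<longleftrightarrow> I \<subseteq> E \<and> fun_subspace I \<and>
     (\<forall>f\<in>E. \<forall>g\<in>I. (\<lambda>x. \<bar>f x\<bar>) \<le> (\<lambda>x. \<bar>g x\<bar>) \<longrightarrow> f \<in> I)"

definition FVL :: "(('x::banach \<Rightarrow>\<^sub>L real) \<Rightarrow> real) set" where
  "FVL = vector_sublattice H_wstar hull range eval_at"

definition FBL :: "'x::banach itself \<Rightarrow> real \<Rightarrow> (('x \<Rightarrow>\<^sub>L real) \<Rightarrow> real) set" where
  "FBL _ p = Hp_closure p FVL"

definition I_wstar :: "(('x::banach \<Rightarrow>\<^sub>L real) \<Rightarrow> real) set" where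
  "I_wstar = order_ideal H_wstar hull range eval_at"

definition Ip_wstar :: "'x::banach itself \<Rightarrow> real \<Rightarrow> (('x \<Rightarrow>\<^sub>L real) \<Rightarrow> real) set" where
  "Ip_wstar _ p = Hp_closure p I_wstar"


section \<open>The Fatou property and monotonic boundedness\<close>

text \<open>A Banach lattice is given by a carrier \<open>Z\<close> in an ambient type, whose order it inherits,
  and by its norm \<open>N\<close>, taken with values in \<^typ>\<open>ennreal\<close> (and finite on \<open>Z\<close>), so that suprema
  of norms over norm-unbounded sets are \<open>\<infinity>\<close>. Suprema and upper bounds are taken in \<open>Z\<close>, not in
  the ambient type.\<close>

definition is_supremum_in :: "'a::order set \<Rightarrow> 'a set \<Rightarrow> 'a \<Rightarrow> bool" where
  "is_supremum_in Z S z \<longleftrightarrow> z \<in> Z \<and> (\<forall>s\<in>S. s \<le> z) \<and> (\<forall>u\<in>Z. (\<forall>s\<in>S. s \<le> u) \<longrightarrow> z \<le> u)"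

definition upward_directed :: "'a::order set \<Rightarrow> bool" where
  "upward_directed S \<longleftrightarrow> S \<noteq> {} \<and> (\<forall>a\<in>S. \<forall>b\<in>S. \<exists>c\<in>S. a \<le> c \<and> b \<le> c)"

definition fatou_property :: "('b \<Rightarrow> real) set \<Rightarrow> (('b \<Rightarrow> real) \<Rightarrow> ennreal) \<Rightarrow> real \<Rightarrow> bool" where
  "fatou_property Z N lam \<longleftrightarrow>
     (\<forall>S z. S \<subseteq> {f \<in> Z. (\<lambda>_. 0) \<le> f} \<and> upward_directed S \<and> is_supremum_in Z S z \<longrightarrow>
        N z \<le> ennreal lam * (SUP s\<in>S. N s))"

text \<open>Nets are indexed by preordered directed subsets \<open>J\<close> of the ambient type. This is no loss of
  generality: an increasing net has the same upper bounds as its range, and the range is directed.\<close>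

definition monotonically_bounded ::
  "('b \<Rightarrow> real) set \<Rightarrow> (('b \<Rightarrow> real) \<Rightarrow> ennreal) \<Rightarrow> bool" where
  "monotonically_bounded Z N \<longleftrightarrow>
     (\<forall>(J :: ('b \<Rightarrow> real) set) r z.
        J \<noteq> {} \<and> preorder_on J r \<and> (\<forall>i\<in>J. \<forall>j\<in>J. \<exists>k\<in>J. (i, k) \<in> r \<and> (j, k) \<in> r) \<and>
        z ` J \<subseteq> {f \<in> Z. (\<lambda>_. 0) \<le> f} \<and> (\<forall>(i, j)\<in>r. z i \<le> z j) \<and>
        (\<exists>C::real. \<forall>i\<in>J. N (z i) \<le> ennreal C) \<longrightarrow>
        (\<exists>u\<in>Z. \<forall>i\<in>J. z i \<le> u))"

end

theory Submission
  imports Defs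
begin

text \<open>
  For a node \<open>v\<close> let \<open>\<theta>\<^sub>v\<close> be the average, over the branches through \<open>v\<close>, of the functionals on
  \<open>JT\<close> that sum along a branch; the averaging puts it in \<open>JT\<^sub>*\<close>, with norm at most 5. The functions
  \<open>2\<^bsup>-k/p\<^esup> |\<delta>(\<theta>\<^sub>v)|\<close>, \<open>v\<close> in level \<open>k\<close>, and all finite maxima of such functions are dominated by
  \<open>(2\<^bsup>-k\<^esup> \<Sum>\<^sub>v |\<delta>(\<theta>\<^sub>v)|\<^sup>p)\<^bsup>1/p\<^esup>\<close> for large \<open>k\<close>, hence have \<open>p\<close>-norm at most 5.

  On the other hand, for \<open>p \<ge> 2\<close> the \<open>2\<^sup>k\<close> unit vectors \<open>e\<^sup>*\<^sub>v\<close> of level \<open>k\<close> have weak \<open>p\<close>-norm at most 1,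
  while for large suitable \<open>k\<close> most of them almost vanish (at the scale \<open>2\<^bsup>-k/2\<^esup>\<close>) on any given finite
  subset of \<open>JT\<^sup>*\<close>, since \<open>\<Sum>\<^sub>v |y(e\<^sup>*\<^sub>v)|\<close> over level \<open>k\<close> is \<open>o(2\<^bsup>k/2\<^esup>)\<close> along a sequence of levels.
  A function \<open>u\<close> that is \<open>p\<close>-norm close to one depending on finitely many evaluations therefore takes
  almost the value \<open>u(x)\<close> at some \<open>x + M 2\<^bsup>k/p\<^esup> e\<^sup>*\<^sub>v\<close>, although \<open>2\<^bsup>-k/p\<^esup> |\<delta>(\<theta>\<^sub>v)|\<close> is about \<open>M\<close> there.

  With \<open>x = 0\<close> this shows that the above functions have no upper bound in the closed ideal.
  With arbitrary \<open>x\<close> it shows that, for every \<open>d > 0\<close>, the functions below both \<open>d\<close> times such a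
  maximum and \<open>|\<delta>(e\<^sub>0\<^sub>1)|\<close> have supremum \<open>|\<delta>(e\<^sub>0\<^sub>1)|\<close> in the free Banach lattice: norms at most
  \<open>5 d\<close> against norm 1.
\<close>

section \<open>Lattices of weak* continuous positively homogeneous functions\<close>

lemma H_wstar_zero: "(\<lambda>_. 0) \<in> H_wstar"
  by (simp add: H_wstar_def positively_homogeneous_def)

lemma H_wstar_add: "f \<in> H_wstar \<Longrightarrow> g \<in> H_wstar \<Longrightarrow> (\<lambda>x. f x + g x) \<in> H_wstar"
  by (auto simp: H_wstar_def positively_homogeneous_def algebra_simps intro!: continuous_intros)

lemma H_wstar_scale: "f \<in> H_wstar \<Longrightarrow> (\<lambda>x. c * f x) \<in> H_wstar"
  by (auto simp: H_wstar_def positively_homogeneous_def algebra_simps intro!: continuous_intros)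

lemma H_wstar_sup:
  assumes "f \<in> H_wstar" "g \<in> H_wstar" shows "sup f g \<in> H_wstar"
proof -
  have "continuous_map (subtopology weak_star_topology B) euclideanreal (\<lambda>x. max (f x) (g x))"
    if "bounded B" for B
    using assms that by (intro continuous_map_real_max) (auto simp: H_wstar_def)
  moreover have "max (c * f x) (c * g x) = c * max (f x) (g x)" if "0 \<le> c" for c x
    using that by (simp add: max_mult_distrib_left)
  ultimately show ?thesis
    using assms by (auto simp: H_wstar_def positively_homogeneous_def sup_fun_def sup_max)
qed

lemma H_wstar_inf:
  assumes "f \<in> H_wstar" "g \<in> H_wstar" shows "inf f g \<in> H_wstar"
proof -
  have "inf f g = (\<lambda>x. -1 * sup (\<lambda>x. -1 * f x) (\<lambda>x. -1 * g x) x)"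
    by (auto simp: fun_eq_iff inf_min sup_max)
  thus ?thesis
    using assms by (auto simp only: intro: H_wstar_scale H_wstar_sup)
qed

lemma vector_sublattice_H_wstar: "vector_sublattice H_wstar H_wstar"
  by (simp add: vector_sublattice_def fun_subspace_def H_wstar_zero H_wstar_add H_wstar_scale
      H_wstar_sup H_wstar_inf)

lemma eval_at_in_H_wstar: "eval_at y \<in> H_wstar"
  by (auto simp: H_wstar_def positively_homogeneous_def eval_at_def blinfun.scaleR_left
      intro!: continuous_map_from_subtopology strong_operator_topology_continuous_evaluation)

text \<open>Intersections of nonempty families inherit the property. The set \<open>E\<close> itself
  belongs to the family, which forces the hull into \<open>E\<close>.\<close>

lemma vector_sublattice_hull:
  assumes E: "vector_sublattice E E" and "A \<subseteq> E"
  shows "vector_sublattice E (vector_sublattice E hull A)"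
proof -
  have "vector_sublattice E hull A \<subseteq> E"
    using assms by (intro hull_minimal)
  moreover have "fun_subspace (vector_sublattice E hull A)"
    unfolding hull_def fun_subspace_def[of "\<Inter>_"]
    by (auto simp: vector_sublattice_def fun_subspace_def)
  ultimately show ?thesis
    unfolding vector_sublattice_def[of E "_ hull _"]
    by (auto simp: hull_def vector_sublattice_def)
qed

lemma order_ideal_hull:
  assumes E: "order_ideal E E" and "A \<subseteq> E"
  shows "order_ideal E (order_ideal E hull A)"
proof -
  have "order_ideal E hull A \<subseteq> E"
    using assms by (intro hull_minimal)
  moreover have "fun_subspace (order_ideal E hull A)"
    unfolding hull_def fun_subspace_def[of "\<Inter>_"]
    by (auto simp: order_ideal_def fun_subspace_def)
  moreover have "f \<in> order_ideal E hull A"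
    if f: "f \<in> E" and g: "g \<in> order_ideal E hull A" and le: "(\<lambda>x. \<bar>f x\<bar>) \<le> (\<lambda>x. \<bar>g x\<bar>)" for f g
    unfolding hull_def
  proof clarify
    fix I assume I: "order_ideal E I" "A \<subseteq> I"
    hence "g \<in> I" using g by (auto simp: hull_def)
    thus "f \<in> I" using I(1) f le unfolding order_ideal_def by blast
  qed
  ultimately show ?thesis
    unfolding order_ideal_def[of E "_ hull _"] by blast
qed

lemma vector_sublattice_abs:
  assumes "vector_sublattice E L" "f \<in> L"
  shows "(\<lambda>x. \<bar>f x\<bar>) \<in> L"
proof -
  have "(\<lambda>x. - 1 * f x) \<in> L"
    using assms unfolding vector_sublattice_def fun_subspace_def by blast
  hence "sup f (\<lambda>x. - 1 * f x) \<in> L"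
    using assms unfolding vector_sublattice_def by blast
  moreover have "sup f (\<lambda>x. - 1 * f x) = (\<lambda>x. \<bar>f x\<bar>)"
    by (auto simp: sup_fun_def sup_max)
  ultimately show ?thesis by simp
qed

text \<open>The function \<open>|f| + |g|\<close> lies in the ideal and dominates both lattice
  operations.\<close>

lemma order_ideal_imp_vector_sublattice:
  assumes E: "vector_sublattice E E" and I: "order_ideal E I"
  shows "vector_sublattice E I"
proof -
  have "sup f g \<in> I \<and> inf f g \<in> I" if fg: "f \<in> I" "g \<in> I" for f g
  proof -
    have IE: "I \<subseteq> E" and sub: "fun_subspace I"
      and dom: "\<And>f g. f \<in> E \<Longrightarrow> g \<in> I \<Longrightarrow> (\<lambda>x. \<bar>f x\<bar>) \<le> (\<lambda>x. \<bar>g x\<bar>) \<Longrightarrow> f \<in> I"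
      using I unfolding order_ideal_def by auto
    have "(\<lambda>x. \<bar>f x\<bar>) \<in> I" if "f \<in> I" for f
      using that IE vector_sublattice_abs[OF E] by (intro dom[OF _ that]) auto
    hence sum: "(\<lambda>x. \<bar>f x\<bar> + \<bar>g x\<bar>) \<in> I"
      using fg sub unfolding fun_subspace_def by auto
    have "sup f g \<in> E" "inf f g \<in> E"
      using E fg IE unfolding vector_sublattice_def by auto
    thus ?thesis
      by (auto intro!: dom[OF _ sum] le_funI simp: sup_max inf_min)
  qed
  thus ?thesis using I by (auto simp: vector_sublattice_def order_ideal_def)
qed

lemma vector_sublattice_FVL: "vector_sublattice H_wstar FVL"
  unfolding FVL_def
  by (rule vector_sublattice_hull[OF vector_sublattice_H_wstar]) (auto intro: eval_at_in_H_wstar)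

lemma eval_at_in_FVL: "eval_at y \<in> FVL"
  unfolding FVL_def by (rule hull_inc) simp

lemma order_ideal_I_wstar: "order_ideal H_wstar I_wstar"
  unfolding I_wstar_def
proof (rule order_ideal_hull)
  show "order_ideal H_wstar H_wstar"
    using vector_sublattice_H_wstar by (auto simp: order_ideal_def vector_sublattice_def)
qed (auto intro: eval_at_in_H_wstar)

lemma FVL_subset_I_wstar: "FVL \<subseteq> I_wstar"
  unfolding FVL_def
proof (rule hull_minimal)
  show "vector_sublattice H_wstar I_wstar"
    by (rule order_ideal_imp_vector_sublattice[OF vector_sublattice_H_wstar order_ideal_I_wstar])
  show "range eval_at \<subseteq> I_wstar"
    unfolding I_wstar_def by (rule hull_subset)
qed

lemmas FVL_subset_H_wstar = vector_sublattice_FVL[unfolded vector_sublattice_def, THEN conjunct1]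

lemma FVL_scale: "f \<in> FVL \<Longrightarrow> (\<lambda>x. c * f x) \<in> FVL"
  and FVL_sup: "f \<in> FVL \<Longrightarrow> g \<in> FVL \<Longrightarrow> sup f g \<in> FVL"
  and FVL_inf: "f \<in> FVL \<Longrightarrow> g \<in> FVL \<Longrightarrow> inf f g \<in> FVL"
  for f :: "('x::banach \<Rightarrow>\<^sub>L real) \<Rightarrow> real"
  using vector_sublattice_FVL[where 'a = 'x]
  unfolding vector_sublattice_def fun_subspace_def by blast+

section \<open>Control of functions by finitely many evaluations\<close>

definition eval_dominated :: "(('x::banach \<Rightarrow>\<^sub>L real) \<Rightarrow> real) \<Rightarrow> bool" where
  "eval_dominated f \<longleftrightarrow>
     (\<exists>F C. finite F \<and> 0 \<le> C \<and> (\<forall>x. \<bar>f x\<bar> \<le> C * (\<Sum>y\<in>F. \<bar>blinfun_apply x y\<bar>)))"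

text \<open>Domination compares a value only with 0. Base points other than 0 require comparing two
  values, and this stronger bound is established for \<open>FVL\<close>, where the lattice
  operations preserve it.\<close>

definition eval_lipschitz :: "(('x::banach \<Rightarrow>\<^sub>L real) \<Rightarrow> real) \<Rightarrow> bool" where
  "eval_lipschitz f \<longleftrightarrow>
     (\<exists>F C. finite F \<and> 0 \<le> C \<and>
        (\<forall>x x'. \<bar>f x - f x'\<bar> \<le> C * (\<Sum>y\<in>F. \<bar>blinfun_apply x y - blinfun_apply x' y\<bar>)))"

lemma eval_dominated_add:
  assumes "eval_dominated f" "eval_dominated g"
  shows "eval_dominated (\<lambda>x. \<bar>f x\<bar> + \<bar>g x\<bar>)"
proof -
  from assms obtain F C G D where FG: "finite F" "finite G" "0 \<le> C" "0 \<le> D"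
    and f: "\<And>x. \<bar>f x\<bar> \<le> C * (\<Sum>y\<in>F. \<bar>blinfun_apply x y\<bar>)"
    and g: "\<And>x. \<bar>g x\<bar> \<le> D * (\<Sum>y\<in>G. \<bar>blinfun_apply x y\<bar>)"
    unfolding eval_dominated_def by blast
  have "\<bar>\<bar>f x\<bar> + \<bar>g x\<bar>\<bar> \<le> (C + D) * (\<Sum>y\<in>F \<union> G. \<bar>blinfun_apply x y\<bar>)" for x
  proof -
    have "(\<Sum>y\<in>F. \<bar>blinfun_apply x y\<bar>) \<le> (\<Sum>y\<in>F \<union> G. \<bar>blinfun_apply x y\<bar>)"
      "(\<Sum>y\<in>G. \<bar>blinfun_apply x y\<bar>) \<le> (\<Sum>y\<in>F \<union> G. \<bar>blinfun_apply x y\<bar>)"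
      using FG by (auto intro!: sum_mono2)
    from mult_left_mono[OF this(1) FG(3)] mult_left_mono[OF this(2) FG(4)] f[of x] g[of x]
    show ?thesis by (simp add: distrib_right)
  qed
  thus ?thesis unfolding eval_dominated_def using FG
    by (intro exI[of _ "F \<union> G"] exI[of _ "C + D"]) auto
qed

lemma eval_dominated_mono:
  assumes "eval_dominated g" "\<And>x. \<bar>f x\<bar> \<le> \<bar>g x\<bar>"
  shows "eval_dominated f"
  using assms unfolding eval_dominated_def by (meson order_trans)

lemma eval_dominated_scale:
  assumes "eval_dominated f" shows "eval_dominated (\<lambda>x. c * f x)"
proof -
  from assms obtain F C where FC: "finite F" "0 \<le> C"
    and f: "\<And>x. \<bar>f x\<bar> \<le> C * (\<Sum>y\<in>F. \<bar>blinfun_apply x y\<bar>)"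
    unfolding eval_dominated_def by blast
  have "\<bar>c * f x\<bar> \<le> \<bar>c\<bar> * C * (\<Sum>y\<in>F. \<bar>blinfun_apply x y\<bar>)" for x
    using mult_left_mono[OF f[of x], of "\<bar>c\<bar>"] by (simp add: abs_mult mult.assoc)
  thus ?thesis unfolding eval_dominated_def using FC
    by (intro exI[of _ F] exI[of _ "\<bar>c\<bar> * C"]) auto
qed

lemma eval_dominated_eval_at: "eval_dominated (eval_at y)"
  unfolding eval_dominated_def
  by (intro exI[of _ "{y}"] exI[of _ 1]) (simp add: eval_at_def)

text \<open>The dominated members of \<open>H_wstar\<close> form an order ideal containing the
  evaluations, so minimality of the hull applies.\<close>

lemma I_wstar_eval_dominated:
  fixes f :: "('x::banach \<Rightarrow>\<^sub>L real) \<Rightarrow> real"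
  assumes "f \<in> I_wstar" shows "eval_dominated f"
proof -
  let ?D = "{f :: ('x \<Rightarrow>\<^sub>L real) \<Rightarrow> real. f \<in> H_wstar \<and> eval_dominated f}"
  have "eval_dominated (\<lambda>x :: 'x \<Rightarrow>\<^sub>L real. 0)"
    using eval_dominated_scale[OF eval_dominated_eval_at, of 0 0] by simp
  moreover have "eval_dominated (\<lambda>x. f x + g x)"
    if "eval_dominated f" "eval_dominated g" for f g :: "('x \<Rightarrow>\<^sub>L real) \<Rightarrow> real"
    using eval_dominated_mono[OF eval_dominated_add[OF that], of "\<lambda>x. f x + g x"] by simp
  ultimately have "fun_subspace ?D"
    by (auto simp: fun_subspace_def eval_dominated_scale H_wstar_zero H_wstar_add H_wstar_scale)
  moreover have "f \<in> ?D" if "f \<in> H_wstar" "g \<in> ?D" "(\<lambda>x. \<bar>f x\<bar>) \<le> (\<lambda>x. \<bar>g x\<bar>)" for f g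
    using that by (auto simp: le_fun_def intro: eval_dominated_mono[of g])
  ultimately have "order_ideal H_wstar ?D"
    unfolding order_ideal_def by blast
  hence "I_wstar \<subseteq> ?D"
    unfolding I_wstar_def
    by (rule hull_minimal[rotated]) (auto intro: eval_at_in_H_wstar eval_dominated_eval_at)
  thus ?thesis using assms by blast
qed

text \<open>The hypothesis on \<open>h\<close> is met by \<open>f + g\<close>,
  \<open>sup f g\<close> and \<open>inf f g\<close> alike, so three closure properties follow at
  once.\<close>

lemma eval_lipschitz_combine:
  assumes "eval_lipschitz f" "eval_lipschitz g"
    and h: "\<And>x x'. \<bar>h x - h x'\<bar> \<le> \<bar>f x - f x'\<bar> + \<bar>g x - g x'\<bar>"
  shows "eval_lipschitz h"
proof -
  from assms(1,2) obtain F C G D where FG: "finite F" "finite G" "0 \<le> C" "0 \<le> D"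
    and f: "\<And>x x'. \<bar>f x - f x'\<bar> \<le> C * (\<Sum>y\<in>F. \<bar>blinfun_apply x y - blinfun_apply x' y\<bar>)"
    and g: "\<And>x x'. \<bar>g x - g x'\<bar> \<le> D * (\<Sum>y\<in>G. \<bar>blinfun_apply x y - blinfun_apply x' y\<bar>)"
    unfolding eval_lipschitz_def by blast
  have "\<bar>h x - h x'\<bar> \<le> (C + D) * (\<Sum>y\<in>F \<union> G. \<bar>blinfun_apply x y - blinfun_apply x' y\<bar>)" for x x'
  proof -
    let ?s = "\<lambda>F. \<Sum>y\<in>F. \<bar>blinfun_apply x y - blinfun_apply x' y\<bar>"
    have "?s F \<le> ?s (F \<union> G)" "?s G \<le> ?s (F \<union> G)"
      using FG by (auto intro!: sum_mono2)
    from mult_left_mono[OF this(1) FG(3)] mult_left_mono[OF this(2) FG(4)]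
      f[of x x'] g[of x x'] h[of x x']
    show ?thesis by (simp add: distrib_right)
  qed
  thus ?thesis unfolding eval_lipschitz_def using FG
    by (intro exI[of _ "F \<union> G"] exI[of _ "C + D"]) auto
qed

lemma eval_lipschitz_scale:
  assumes "eval_lipschitz f" shows "eval_lipschitz (\<lambda>x. c * f x)"
proof -
  from assms obtain F C where FC: "finite F" "0 \<le> C"
    and f: "\<And>x x'. \<bar>f x - f x'\<bar> \<le> C * (\<Sum>y\<in>F. \<bar>blinfun_apply x y - blinfun_apply x' y\<bar>)"
    unfolding eval_lipschitz_def by blast
  have "\<bar>c * f x - c * f x'\<bar> \<le> \<bar>c\<bar> * C * (\<Sum>y\<in>F. \<bar>blinfun_apply x y - blinfun_apply x' y\<bar>)" for x x'
  proof -
    have "\<bar>c * f x - c * f x'\<bar> = \<bar>c\<bar> * \<bar>f x - f x'\<bar>"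
      by (metis abs_mult right_diff_distrib)
    thus ?thesis using mult_left_mono[OF f[of x x'], of "\<bar>c\<bar>"] by (simp only: mult.assoc abs_ge_zero)
  qed
  thus ?thesis unfolding eval_lipschitz_def using FC
    by (intro exI[of _ F] exI[of _ "\<bar>c\<bar> * C"]) auto
qed

lemma FVL_eval_lipschitz:
  fixes f :: "('a::banach \<Rightarrow>\<^sub>L real) \<Rightarrow> real"
  assumes "f \<in> FVL" shows "eval_lipschitz f"
proof -
  let ?D = "{f :: ('a \<Rightarrow>\<^sub>L real) \<Rightarrow> real. f \<in> H_wstar \<and> eval_lipschitz f}"
  have ev: "eval_lipschitz (eval_at y)" for y :: 'a
    unfolding eval_lipschitz_def
    by (intro exI[of _ "{y}"] exI[of _ 1]) (simp add: eval_at_def)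
  have "eval_lipschitz (\<lambda>x :: 'a \<Rightarrow>\<^sub>L real. 0)"
    unfolding eval_lipschitz_def by (intro exI[of _ "{}"] exI[of _ 0]) simp
  hence "fun_subspace ?D"
    by (auto simp: fun_subspace_def eval_lipschitz_scale H_wstar_zero H_wstar_add H_wstar_scale
        intro: eval_lipschitz_combine)
  moreover have "eval_lipschitz (sup f g)" "eval_lipschitz (inf f g)"
    if "eval_lipschitz f" "eval_lipschitz g" for f g :: "('a \<Rightarrow>\<^sub>L real) \<Rightarrow> real"
    by (rule eval_lipschitz_combine[OF that]; auto simp: sup_max inf_min)+
  ultimately have "vector_sublattice H_wstar ?D"
    by (auto simp: vector_sublattice_def intro: H_wstar_sup H_wstar_inf)
  hence "FVL \<subseteq> ?D"
    unfolding FVL_def by (rule hull_minimal[rotated]) (auto intro: eval_at_in_H_wstar ev)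
  thus ?thesis using assms by blast
qed

section \<open>Weak p-norms\<close>

lemma lp_norm_nonneg: "0 \<le> lp_norm p n a"
  by (simp add: lp_norm_def)

lemma lp_norm_powr:
  assumes "p \<noteq> 0" shows "lp_norm p n a powr p = (\<Sum>i<n. \<bar>a i\<bar> powr p)"
  using assms by (simp add: lp_norm_def powr_powr sum_nonneg)

lemma lp_norm_le_iff:
  assumes "0 < p" "0 \<le> c" shows "lp_norm p n a \<le> c \<longleftrightarrow> (\<Sum>i<n. \<bar>a i\<bar> powr p) \<le> c powr p"
proof -
  have "lp_norm p n a \<le> c \<longleftrightarrow> lp_norm p n a powr p \<le> c powr p"
    using assms lp_norm_nonneg[of p n a] powr_mono2[of p "lp_norm p n a" c]
      powr_less_mono2[of p c "lp_norm p n a"] by (meson less_imp_le not_less)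
  thus ?thesis using assms by (simp add: lp_norm_powr)
qed

lemma lp_norm_zero: "lp_norm p n (\<lambda>_. 0) = 0"
  by (simp add: lp_norm_def)

lemma conj_exponent_gt_1: "1 < p \<Longrightarrow> 1 < conj_exponent p"
  by (simp add: conj_exponent_def field_simps)

lemma conj_exponent_le_2: "2 \<le> p \<Longrightarrow> conj_exponent p \<le> 2"
  by (simp add: conj_exponent_def field_simps)

lemma lp_norm_le_1_imp_coord:
  assumes "0 < q" "lp_norm q n a \<le> 1" "i < n"
  shows "\<bar>a i\<bar> \<le> 1"
proof -
  have "\<bar>a i\<bar> powr q \<le> (\<Sum>i<n. \<bar>a i\<bar> powr q)"
    using assms(3) by (intro member_le_sum) auto
  also have "\<dots> \<le> 1" using assms lp_norm_le_iff[of q 1] by simp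
  finally show ?thesis
    using assms(1) powr_less_mono2[of q 1 "\<bar>a i\<bar>"] by (auto simp: not_le[symmetric])
qed

text \<open>A real supremum bounds its members only if the set is bounded above. Admissible
  coefficients have modulus at most 1, so the sum of the norms is a bound.\<close>

lemma weak_lp_norm_upper:
  assumes p: "1 < p" and a: "lp_norm (conj_exponent p) n a \<le> 1"
  shows "norm (\<Sum>i<n. a i *\<^sub>R z i) \<le> weak_lp_norm p n z"
  unfolding weak_lp_norm_def
proof (rule cSUP_upper)
  show "a \<in> {\<alpha>. lp_norm (conj_exponent p) n \<alpha> \<le> 1}" using a by simp
  have "norm (\<Sum>i<n. \<alpha> i *\<^sub>R z i) \<le> (\<Sum>i<n. norm (z i))" if "lp_norm (conj_exponent p) n \<alpha> \<le> 1" for \<alpha>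
  proof -
    have "norm (\<Sum>i<n. \<alpha> i *\<^sub>R z i) \<le> (\<Sum>i<n. \<bar>\<alpha> i\<bar> * norm (z i))"
      by (rule order_trans[OF norm_sum]) simp
    also have "\<dots> \<le> (\<Sum>i<n. norm (z i))"
      using lp_norm_le_1_imp_coord[OF _ that] conj_exponent_gt_1[OF p]
      by (intro sum_mono mult_left_le_one_le) auto
    finally show ?thesis .
  qed
  thus "bdd_above ((\<lambda>\<alpha>. norm (\<Sum>i<n. \<alpha> i *\<^sub>R z i)) ` {\<alpha>. lp_norm (conj_exponent p) n \<alpha> \<le> 1})"
    by (intro bdd_aboveI2) auto
qed

lemma weak_lp_norm_nonneg:
  assumes "1 < p" shows "0 \<le> weak_lp_norm p n z"
  using weak_lp_norm_upper[OF assms, of n "\<lambda>_. 0" z] by (simp add: lp_norm_zero)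

lemma weak_lp_norm_least:
  assumes "\<And>a. lp_norm (conj_exponent p) n a \<le> 1 \<Longrightarrow> norm (\<Sum>i<n. a i *\<^sub>R z i) \<le> B"
  shows "weak_lp_norm p n z \<le> B"
  unfolding weak_lp_norm_def
  using lp_norm_zero[of "conj_exponent p" n]
  by (intro cSUP_least assms) (auto intro!: exI[of _ "\<lambda>_. 0"])

lemma weak_lp_norm_one_le:
  assumes "1 < p" shows "weak_lp_norm p 1 z \<le> norm (z 0)"
proof (rule weak_lp_norm_least)
  fix a :: "nat \<Rightarrow> real" assume "lp_norm (conj_exponent p) 1 a \<le> 1"
  hence "\<bar>a 0\<bar> \<le> 1"
    using lp_norm_le_1_imp_coord[of "conj_exponent p" 1 a 0] conj_exponent_gt_1[OF assms] by simp
  thus "norm (\<Sum>i<1. a i *\<^sub>R z i) \<le> norm (z 0)"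
    by (simp add: mult_left_le_one_le)
qed

text \<open>The coefficients \<open>sgn b |b|\<^sup>p\<^sup>-\<^sup>1\<close>, suitably normalised, attain equality in Hoelder's inequality.\<close>

lemma sum_eval_powr_le:
  fixes x :: "nat \<Rightarrow> 'x::banach \<Rightarrow>\<^sub>L real"
  assumes p: "1 < p"
  shows "(\<Sum>i<n. \<bar>blinfun_apply (x i) y\<bar> powr p) \<le> (norm y * weak_lp_norm p n x) powr p"
proof -
  define b where "b i = blinfun_apply (x i) y" for i
  define A where "A = (\<Sum>i<n. \<bar>b i\<bar> powr p)"
  define q where "q = conj_exponent p"
  have q: "1 < q" "(p - 1) * q = p" "1 - 1 / q = 1 / p"
    using p conj_exponent_gt_1[OF p] by (auto simp: q_def conj_exponent_def field_simps)
  have A0: "0 \<le> A" by (auto simp: A_def intro: sum_nonneg)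
  have "A \<le> (norm y * weak_lp_norm p n x) powr p"
  proof (cases "A = 0")
    case False
    hence A: "0 < A" using A0 by simp
    define a where "a i = sgn (b i) * \<bar>b i\<bar> powr (p - 1) * A powr (- 1 / q)" for i
    have "\<bar>a i\<bar> powr q = \<bar>b i\<bar> powr p * inverse A" for i
    proof (cases "b i = 0")
      case False
      have "\<bar>a i\<bar> = \<bar>b i\<bar> powr (p - 1) * A powr (- 1 / q)"
        using False by (simp add: a_def abs_mult)
      hence "\<bar>a i\<bar> powr q = \<bar>b i\<bar> powr ((p - 1) * q) * A powr (-1)"
        using q(1) by (simp add: powr_mult powr_powr)
      thus ?thesis using A q(2) by (simp add: powr_minus)
    qed (use p q in \<open>simp add: a_def\<close>)
    hence "(\<Sum>i<n. \<bar>a i\<bar> powr q) = A * inverse A"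
      by (simp add: A_def sum_distrib_right)
    hence "lp_norm q n a \<le> 1"
      using A q lp_norm_le_iff[of q 1 n a] by simp
    hence "norm (\<Sum>i<n. a i *\<^sub>R x i) \<le> weak_lp_norm p n x"
      using weak_lp_norm_upper[OF p] by (simp add: q_def)
    hence "norm (\<Sum>i<n. a i *\<^sub>R x i) * norm y \<le> weak_lp_norm p n x * norm y"
      by (rule mult_right_mono) simp
    with norm_blinfun[of "\<Sum>i<n. a i *\<^sub>R x i" y]
    have le: "\<bar>\<Sum>i<n. a i * b i\<bar> \<le> weak_lp_norm p n x * norm y"
      by (simp add: blinfun.sum_left blinfun.scaleR_left b_def)
    have "a i * b i = \<bar>b i\<bar> powr p * A powr (- 1 / q)" for i
    proof (cases "b i = 0")
      case False
      have "a i * b i = \<bar>b i\<bar> powr (p - 1) * \<bar>b i\<bar> powr 1 * A powr (- 1 / q)"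
        using False by (simp add: a_def sgn_if)
      thus ?thesis by (simp only: powr_add[symmetric]) simp
    qed (simp add: a_def)
    hence "(\<Sum>i<n. a i * b i) = A * A powr (- 1 / q)"
      by (simp add: A_def sum_distrib_right)
    also have "\<dots> = A powr 1 * A powr (- 1 / q)" using A by simp
    also have "\<dots> = A powr (1 / p)"
      by (simp only: powr_add[symmetric]) (use q in simp)
    finally have "A powr (1 / p) \<le> weak_lp_norm p n x * norm y" using le by simp
    hence "(A powr (1 / p)) powr p \<le> (weak_lp_norm p n x * norm y) powr p"
      using p by (intro powr_mono2) auto
    thus ?thesis using p A by (simp add: powr_powr mult.commute)
  qed simp
  thus ?thesis by (simp add: A_def b_def)
qed

section \<open>Bounds for and from the \<open>p\<close>-norm of a function\<close>

lemma p_norm_le: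
  fixes f :: "('x::banach \<Rightarrow>\<^sub>L real) \<Rightarrow> real"
  assumes p: "1 < p" and "0 \<le> C"
    and "\<And>n x. (\<Sum>i<n. \<bar>f (x i)\<bar> powr p) \<le> (C * weak_lp_norm p n x) powr p"
  shows "p_norm p f \<le> ennreal C"
proof -
  have "lp_norm p n (\<lambda>i. f (x i)) \<le> C * weak_lp_norm p n x" for n x
    using assms weak_lp_norm_nonneg[OF p, of n x] by (subst lp_norm_le_iff) auto
  thus ?thesis
    unfolding p_norm_def using assms(2) by (intro Inf_lower) auto
qed

text \<open>Strictness provides an admissible constant \<open>D\<close> below \<open>C\<close>; the
  weak norm being nonnegative, \<open>D\<close> may be raised to \<open>C\<close>.\<close>

lemma p_norm_less_imp:
  fixes f :: "('x::banach \<Rightarrow>\<^sub>L real) \<Rightarrow> real"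
  assumes p: "1 < p" and "p_norm p f < ennreal C"
  shows "lp_norm p n (\<lambda>i. f (x i)) \<le> C * weak_lp_norm p n x"
proof -
  from assms(2) obtain D where D: "0 \<le> D" "ennreal D < ennreal C"
    "lp_norm p n (\<lambda>i. f (x i)) \<le> D * weak_lp_norm p n x"
    unfolding p_norm_def Inf_less_iff by blast
  hence "D * weak_lp_norm p n x \<le> C * weak_lp_norm p n x"
    using weak_lp_norm_nonneg[OF p] by (intro mult_right_mono) (auto simp: ennreal_less_iff)
  thus ?thesis using D by linarith
qed

lemma p_norm_less_imp_pointwise:
  fixes f :: "('x::banach \<Rightarrow>\<^sub>L real) \<Rightarrow> real"
  assumes p: "1 < p" and "p_norm p f < ennreal C" "0 \<le> C"
  shows "\<bar>f x\<bar> \<le> C * norm x"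
proof -
  have "lp_norm p 1 (\<lambda>i. f x) \<le> C * weak_lp_norm p 1 (\<lambda>_. x)"
    by (rule p_norm_less_imp[OF assms(1,2)])
  also have "\<dots> \<le> C * norm x"
    using weak_lp_norm_one_le[OF p, of "\<lambda>_. x"] assms(3) by (intro mult_left_mono)
  finally show ?thesis using p by (simp add: lp_norm_def powr_powr)
qed

lemma p_norm_abs_eval_at_le:
  assumes "1 < p" shows "p_norm p (\<lambda>x. \<bar>eval_at y x\<bar>) \<le> ennreal (norm y)"
  using assms by (intro p_norm_le) (auto simp: eval_at_def sum_eval_powr_le)

lemma subset_Hp_closure:
  assumes p: "1 < p" and "f \<in> A" "f \<in> Hp_wstar p"
  shows "f \<in> Hp_closure p A"
proof -
  have "p_norm p (\<lambda>x. f x - f x) \<le> ennreal 0"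
    by (rule p_norm_le[OF p]) (use p in auto)
  thus ?thesis
    using assms by (auto simp: Hp_closure_def intro!: bexI[of _ f])
qed

section \<open>Estimates in the James tree space\<close>

definition level :: "nat \<Rightarrow> (nat \<times> nat) set" where
  "level k = {k} \<times> {1..2 ^ k}"

definition left_child :: "nat \<times> nat \<Rightarrow> nat \<times> nat" where
  "left_child v = (Suc (fst v), 2 * snd v - 1)"

definition right_child :: "nat \<times> nat \<Rightarrow> nat \<times> nat" where
  "right_child v = (Suc (fst v), 2 * snd v)"

text \<open>With indices shifted to start at 0, passing to the parent is halving, so the ancestor at
  level \<open>j\<close> arises by dividing by a power of 2. The node itself is excluded.\<close>

definition ancestors :: "nat \<times> nat \<Rightarrow> (nat \<times> nat) set" where
  "ancestors v = (\<lambda>j. (j, (snd v - 1) div 2 ^ (fst v - j) + 1)) ` {..<fst v}"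

definition descendants :: "nat \<Rightarrow> nat \<times> nat \<Rightarrow> (nat \<times> nat) set" where
  "descendants j v = {fst v + j} \<times> {2 ^ j * (snd v - 1)<..2 ^ j * snd v}"

lemma sum_level: "sum F (level k) = (\<Sum>i=1..2 ^ k. F (k, i))"
proof -
  have "level k = Pair k ` {1..2 ^ k}" by (auto simp: level_def)
  thus ?thesis by (simp add: sum.reindex inj_on_def)
qed

lemma finite_level: "finite (level k)" and card_level: "card (level k) = 2 ^ k"
  by (auto simp: level_def card_cartesian_product)

lemma level_subset: "level k \<subseteq> tree_nodes"
  by (auto simp: level_def tree_nodes_def)

lemma tree_nodes_iff_level: "v \<in> tree_nodes \<longleftrightarrow> v \<in> level (fst v)"
  by (auto simp: level_def tree_nodes_def)

lemma finite_ancestors: "finite (ancestors v)" and finite_descendants: "finite (descendants j v)"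
  by (auto simp: ancestors_def descendants_def)

lemma children_in_tree_nodes:
  assumes "v \<in> tree_nodes" shows "left_child v \<in> tree_nodes" "right_child v \<in> tree_nodes"
  using assms by (auto simp: tree_nodes_def left_child_def right_child_def)

lemma sum_level_Suc: "sum F (level (Suc k)) = (\<Sum>v\<in>level k. F (left_child v) + F (right_child v))"
proof -
  have "(\<Sum>i=1..2 * n. G i) = (\<Sum>i=1..n. G (2 * i - 1) + G (2 * i))" for G :: "nat \<Rightarrow> 'a" and n
    by (induction n) (simp_all add: add.assoc)
  from this[of "\<lambda>i. F (Suc k, i)" "2 ^ k"] show ?thesis
    by (simp add: sum_level left_child_def right_child_def)
qed

lemma ancestors_children:
  assumes "v \<in> tree_nodes"
  shows "ancestors (left_child v) = insert v (ancestors v)"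
    "ancestors (right_child v) = insert v (ancestors v)"
proof -
  have i: "1 \<le> snd v" using assms by (auto simp: tree_nodes_def)
  have "(2 * snd v - 2) div 2 ^ (Suc (fst v) - j) = (snd v - 1) div 2 ^ (fst v - j)"
    "(2 * snd v - 1) div 2 ^ (Suc (fst v) - j) = (snd v - 1) div 2 ^ (fst v - j)"
    if "j < Suc (fst v)" for j
  proof -
    have "(2 * snd v - 2) div 2 = snd v - 1" "(2 * snd v - 1) div 2 = snd v - 1"
      using i by auto
    thus "(2 * snd v - 2) div 2 ^ (Suc (fst v) - j) = (snd v - 1) div 2 ^ (fst v - j)"
      "(2 * snd v - 1) div 2 ^ (Suc (fst v) - j) = (snd v - 1) div 2 ^ (fst v - j)"
      using that by (simp_all add: Suc_diff_le div_mult2_eq)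
  qed
  hence "ancestors (left_child v) = (\<lambda>j. (j, (snd v - 1) div 2 ^ (fst v - j) + 1)) ` {..<Suc (fst v)}"
    "ancestors (right_child v) = (\<lambda>j. (j, (snd v - 1) div 2 ^ (fst v - j) + 1)) ` {..<Suc (fst v)}"
    unfolding ancestors_def left_child_def right_child_def by (auto intro!: image_cong simp: numeral_2_eq_2)
  thus "ancestors (left_child v) = insert v (ancestors v)"
    "ancestors (right_child v) = insert v (ancestors v)"
    using i by (simp_all add: ancestors_def lessThan_Suc)
qed

lemma not_in_ancestors: "v \<notin> ancestors v"
  by (metis (no_types, lifting) ancestors_def fst_conv image_iff lessThan_iff nat_neq_iff)

lemma descendants_0: "v \<in> tree_nodes \<Longrightarrow> descendants 0 v = {v}"
  by (auto simp: descendants_def tree_nodes_def)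

lemma sum_descendants_Suc:
  assumes "v \<in> tree_nodes"
  shows "sum F (descendants (Suc j) v) =
    sum F (descendants j (left_child v)) + sum F (descendants j (right_child v))"
proof -
  obtain m where m: "snd v = Suc m" using assms by (cases "snd v") (auto simp: tree_nodes_def)
  have "descendants (Suc j) v = descendants j (left_child v) \<union> descendants j (right_child v)"
    "descendants j (left_child v) \<inter> descendants j (right_child v) = {}"
    by (auto simp: descendants_def left_child_def right_child_def m algebra_simps)
  thus ?thesis by (simp add: sum.union_disjoint finite_descendants)
qed

lemma descendants_subset:
  assumes "v \<in> tree_nodes" shows "descendants j v \<subseteq> tree_nodes"
proof -
  have "2 ^ j * snd v \<le> 2 ^ (fst v + j)"
    using assms by (auto simp: tree_nodes_def power_add)
  thus ?thesis by (auto simp: descendants_def tree_nodes_def)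
qed

lemma card_descendants:
  assumes "v \<in> tree_nodes" shows "card (descendants j v) = 2 ^ j"
proof -
  have "2 ^ j * snd v - 2 ^ j * (snd v - 1) = 2 ^ j"
    using assms by (simp add: tree_nodes_def case_prod_beta flip: diff_mult_distrib2)
  thus ?thesis by (simp add: descendants_def card_cartesian_product)
qed

lemma tree_segment_finite: "tree_segment S \<Longrightarrow> finite S"
  and tree_segment_inj_fst: "tree_segment S \<Longrightarrow> inj_on fst S"
  by (auto simp: tree_segment_def inj_on_def)

text \<open>This is the path from the root to the parent of \<open>v\<close>. The root must be
  excluded because segments are nonempty.\<close>

lemma tree_segment_ancestors:
  assumes v: "v \<in> tree_nodes" and "ancestors v \<noteq> {}"
  shows "tree_segment (ancestors v)"
proof -
  define n where "n = fst v - 1"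
  define i where "i j = (snd v - 1) div 2 ^ (fst v - j) + 1" for j
  have n: "fst v = Suc n" using assms by (cases "fst v") (auto simp: ancestors_def n_def)
  have lt: "snd v - 1 < 2 ^ fst v" using v by (auto simp: tree_nodes_def)
  have "i j \<le> 2 ^ j" if "j \<le> n" for j
  proof -
    have "snd v - 1 < 2 ^ j * 2 ^ (fst v - j)"
      using lt that n by (simp flip: power_add)
    thus ?thesis by (simp add: i_def less_mult_imp_div_less Suc_le_eq)
  qed
  moreover have "direct_descendant (j + 1, i (j + 1)) (j, i j)" if "j < n" for j
  proof -
    have "fst v - j = Suc (fst v - (j + 1))" using that n by simp
    hence "i j = (snd v - 1) div 2 ^ (fst v - (j + 1)) div 2 + 1"
      by (simp add: i_def div_mult2_eq[symmetric] mult.commute)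
    hence "i j = (i (j + 1) - 1) div 2 + 1" by (simp add: i_def)
    moreover have "1 \<le> i (j + 1)" by (simp add: i_def)
    ultimately have "i (j + 1) = 2 * i j - 1 \<or> i (j + 1) = 2 * i j" by presburger
    thus ?thesis by (simp add: direct_descendant_def)
  qed
  moreover have "ancestors v = (\<lambda>j. (j, i j)) ` {0..n}"
    by (auto simp: ancestors_def n i_def lessThan_Suc_atMost atLeast0AtMost)
  ultimately show ?thesis
    unfolding tree_segment_def
    by (intro exI[of _ 0] exI[of _ n] exI[of _ i]) (auto simp: tree_nodes_def i_def)
qed

section \<open>Norm estimates for coordinates and for sums of unit vectors\<close>

lemma jt_apply_eq_coord: "jt_apply a v = blinfun_apply (jt_coord v) a"
  by (simp add: jt_coord.rep_eq)

lemma bdd_above_jt_values: "bdd_above (jt_values (jt_apply a))"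
  using jt_apply[of a] by (simp add: jt_families_def)

lemma L2_set_segments_le_norm:
  "segment_family \<S> \<Longrightarrow> L2_set (\<lambda>S. sum (jt_apply a) S) \<S> \<le> norm a"
  unfolding norm_jt.rep_eq by (rule jt_nrm_upper[OF bdd_above_jt_values])

text \<open>Singletons are pairwise disjoint segments.\<close>

lemma L2_set_nodes_le_norm:
  assumes "finite W" "W \<subseteq> tree_nodes"
  shows "L2_set (jt_apply a) W \<le> norm a"
proof -
  have "segment_family ((\<lambda>v. {v}) ` W)"
    using assms tree_segment_singleton by (auto simp: segment_family_def pairwise_def)
  from L2_set_segments_le_norm[OF this, of a] show ?thesis
    by (simp add: L2_set_def sum.reindex)
qed

lemma abs_sum_nodes_le:
  assumes "finite W" "W \<subseteq> tree_nodes"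
  shows "\<bar>\<Sum>v\<in>W. jt_apply a v\<bar> \<le> sqrt (card W) * norm a"
proof -
  have "\<bar>\<Sum>v\<in>W. jt_apply a v\<bar> \<le> (\<Sum>v\<in>W. \<bar>1\<bar> * \<bar>jt_apply a v\<bar>)" by simp
  also have "\<dots> \<le> L2_set (\<lambda>_. 1) W * L2_set (jt_apply a) W"
    by (rule L2_set_mult_ineq)
  also have "\<dots> \<le> sqrt (card W) * norm a"
    using L2_set_nodes_le_norm[OF assms] by (simp add: L2_set_def mult_left_mono)
  finally show ?thesis .
qed

lemma abs_sum_segment_le:
  assumes "tree_segment S"
  shows "\<bar>\<Sum>v\<in>S. jt_apply a v\<bar> \<le> norm a"
  using L2_set_segments_le_norm[of "{S}" a] assms by (simp add: segment_family_def)

lemma jt_apply_sum_unit: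
  assumes "finite B" "B \<subseteq> tree_nodes"
  shows "jt_apply (\<Sum>v\<in>B. c v *\<^sub>R jt_unit v) w = (if w \<in> B then c w else 0)"
proof -
  have "jt_apply (\<Sum>v\<in>B. c v *\<^sub>R jt_unit v) w = (\<Sum>v\<in>B. if w = v then c v else 0)"
    unfolding jt_apply_eq_coord blinfun.sum_right blinfun.scaleR_right
    using assms(2) by (intro sum.cong) (auto simp: jt_coord_unit)
  thus ?thesis using assms(1) by (simp add: sum.delta)
qed

text \<open>Disjoint segments cut disjoint pieces from \<open>B\<close>, so squared segment sums
  controlled by an additive weight \<open>d\<close> add up to at most the total weight. The
  estimates for one level and for several levels both come from here.\<close>

lemma norm_sum_unit_le:
  assumes B: "finite B" "B \<subseteq> tree_nodes" and "0 \<le> K" and d: "\<And>v. v \<in> B \<Longrightarrow> 0 \<le> d v"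
    and seg: "\<And>S. tree_segment S \<Longrightarrow> (\<Sum>v\<in>S \<inter> B. c v)\<^sup>2 \<le> K\<^sup>2 * (\<Sum>v\<in>S \<inter> B. d v)"
  shows "norm (\<Sum>v\<in>B. c v *\<^sub>R jt_unit v) \<le> K * sqrt (\<Sum>v\<in>B. d v)"
  unfolding norm_jt.rep_eq
proof (rule jt_nrm_least(2))
  fix \<S> assume S: "segment_family \<S>"
  hence fin: "finite \<S>" and segS: "\<And>S. S \<in> \<S> \<Longrightarrow> tree_segment S"
    by (auto simp: segment_family_def)
  have "sum (jt_apply (\<Sum>v\<in>B. c v *\<^sub>R jt_unit v)) S = (\<Sum>v\<in>S \<inter> B. c v)" if "S \<in> \<S>" for S
    using tree_segment_finite[OF segS[OF that]] by (simp add: jt_apply_sum_unit[OF B] sum.inter_restrict)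
  hence "(\<Sum>S\<in>\<S>. (sum (jt_apply (\<Sum>v\<in>B. c v *\<^sub>R jt_unit v)) S)\<^sup>2) \<le>
      (\<Sum>S\<in>\<S>. K\<^sup>2 * (\<Sum>v\<in>S \<inter> B. d v))"
    using seg segS by (intro sum_mono) simp
  also have "\<dots> = K\<^sup>2 * (\<Sum>v\<in>(\<Union>S\<in>\<S>. S \<inter> B). d v)"
  proof -
    have "\<forall>S\<in>\<S>. \<forall>T\<in>\<S>. S \<noteq> T \<longrightarrow> S \<inter> B \<inter> (T \<inter> B) = {}"
      using S unfolding segment_family_def pairwise_def disjnt_def by blast
    thus ?thesis
      using fin B(1) by (subst sum.UNION_disjoint) (auto simp: sum_distrib_left)
  qed
  also have "\<dots> \<le> K\<^sup>2 * (\<Sum>v\<in>B. d v)"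
    using B d by (intro mult_left_mono sum_mono2) auto
  finally have "L2_set (\<lambda>S. sum (jt_apply (\<Sum>v\<in>B. c v *\<^sub>R jt_unit v)) S) \<S> \<le> sqrt (K\<^sup>2 * (\<Sum>v\<in>B. d v))"
    by (simp add: L2_set_def)
  thus "L2_set (\<lambda>S. sum (jt_apply (\<Sum>v\<in>B. c v *\<^sub>R jt_unit v)) S) \<S> \<le> K * sqrt (\<Sum>v\<in>B. d v)"
    using \<open>0 \<le> K\<close> by (simp add: real_sqrt_mult)
qed

text \<open>A segment meets a level in at most one node, so the segment estimate is trivial with the
  squares of \<open>c\<close> as weight.\<close>

lemma norm_sum_unit_level_le:
  "norm (\<Sum>v\<in>level k. c v *\<^sub>R jt_unit v) \<le> sqrt (\<Sum>v\<in>level k. (c v)\<^sup>2)"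
proof -
  have "(\<Sum>v\<in>S \<inter> level k. c v)\<^sup>2 \<le> 1\<^sup>2 * (\<Sum>v\<in>S \<inter> level k. (c v)\<^sup>2)" if "tree_segment S" for S
  proof (cases "S \<inter> level k = {}")
    case False
    then obtain v where v: "v \<in> S \<inter> level k" by blast
    have "w = v" if "w \<in> S \<inter> level k" for w
      using that v inj_onD[OF tree_segment_inj_fst[OF \<open>tree_segment S\<close>], of w v]
      by (auto simp: level_def)
    hence "S \<inter> level k = {v}" using v by blast
    thus ?thesis by simp
  qed simp
  from norm_sum_unit_le[OF finite_level level_subset _ _ this] show ?thesis by simp
qed

section \<open>Geometric sums and combinations over several levels\<close>

lemma sqrt_half_power: "((1 / sqrt 2) ^ k)\<^sup>2 = (1 / 2 :: real) ^ k"
  by (simp add: power_mult[symmetric] mult.commute[of k] power_mult power_divide)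

lemma inverse_sqrt_2_le: "1 / sqrt 2 \<le> (3 / 4 :: real)"
proof -
  have "4 / 3 \<le> sqrt (2::real)" by (rule real_le_rsqrt) (simp add: power2_eq_square)
  thus ?thesis by (simp add: field_simps)
qed

lemma suminf_inverse_sqrt_2:
  "summable (\<lambda>k. (1 / sqrt 2 :: real) ^ k)" "(\<Sum>k. (1 / sqrt 2 :: real) ^ k) \<le> 4"
proof -
  have lt: "norm (1 / sqrt 2 :: real) < 1" by simp
  show "summable (\<lambda>k. (1 / sqrt 2 :: real) ^ k)" by (rule summable_geometric[OF lt])
  have "1 / (1 - 1 / sqrt 2) \<le> 1 / (1 - 3 / 4 :: real)"
    using inverse_sqrt_2_le by (intro divide_left_mono) auto
  also have "1 / (1 - 3 / 4) = (4 :: real)" by simp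
  finally have "1 / (1 - 1 / sqrt 2) \<le> (4 :: real)" .
  thus "(\<Sum>k. (1 / sqrt 2 :: real) ^ k) \<le> 4"
    by (simp only: suminf_geometric[OF lt])
qed

text \<open>A geometric sum is comparable with its largest term, at \<open>m = Min A\<close>: it is
  at most \<open>4 * r ^ m\<close>, and the square of \<open>r ^ m\<close> is
  \<open>(1 / 2) ^ m\<close>, one of the summands on the right.\<close>

lemma sum_inverse_sqrt_2_squared_le:
  fixes A :: "nat set"
  assumes "finite A"
  shows "(\<Sum>k\<in>A. (1 / sqrt 2) ^ k)\<^sup>2 \<le> 16 * (\<Sum>k\<in>A. (1 / 2 :: real) ^ k)"
proof (cases "A = {}")
  case False
  define r where "r = (1 / sqrt 2 :: real)"
  define m where "m = Min A"
  have m: "m \<in> A" "\<And>k. k \<in> A \<Longrightarrow> m \<le> k" using assms False by (auto simp: m_def)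
  have "inj_on (\<lambda>k. k - m) A"
    using m by (auto simp: inj_on_def) (metis le_add_diff_inverse)
  hence "(\<Sum>k\<in>A. r ^ (k - m)) = (\<Sum>k\<in>(\<lambda>k. k - m) ` A. r ^ k)"
    by (simp add: sum.reindex)
  also have "\<dots> \<le> (\<Sum>k. r ^ k)"
    using assms suminf_inverse_sqrt_2 by (intro sum_le_suminf) (auto simp: r_def)
  finally have le4: "(\<Sum>k\<in>A. r ^ (k - m)) \<le> 4" using suminf_inverse_sqrt_2(2) by (simp add: r_def)
  have "(\<Sum>k\<in>A. r ^ k) = r ^ m * (\<Sum>k\<in>A. r ^ (k - m))"
    unfolding sum_distrib_left by (intro sum.cong) (use m in \<open>simp_all flip: power_add\<close>)
  also have "\<dots> \<le> r ^ m * 4" using le4 by (intro mult_left_mono) (auto simp: r_def)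
  finally have "(\<Sum>k\<in>A. r ^ k)\<^sup>2 \<le> (r ^ m * 4)\<^sup>2"
    by (intro power_mono sum_nonneg) (auto simp: r_def)
  also have "\<dots> = 16 * (1 / 2) ^ m"
    using sqrt_half_power[of m] by (simp add: power_mult_distrib r_def)
  also have "\<dots> \<le> 16 * (\<Sum>k\<in>A. (1 / 2 :: real) ^ k)"
    using m assms by (intro mult_left_mono member_le_sum) auto
  finally show ?thesis by (simp add: r_def)
qed simp

lemma sum_Sigma_levels:
  assumes "finite A"
  shows "sum F (SIGMA k:A. {1..2 ^ k :: nat}) = (\<Sum>k\<in>A. \<Sum>i=1..2 ^ k. F (k, i))"
  using assms by (subst sum.Sigma) (auto simp: case_prod_beta)

text \<open>A segment has at most one node per level, so
  \<open>sum_inverse_sqrt_2_squared_le\<close> gives the segment estimate with weight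
  \<open>(1 / 2) ^ k\<close> at level \<open>k\<close>. Each level then has total weight 1.\<close>

lemma norm_sum_unit_levels_le:
  assumes A: "finite A" and c: "\<And>v. \<bar>c v\<bar> \<le> (1 / sqrt 2) ^ fst v"
  shows "norm (\<Sum>v\<in>(SIGMA k:A. {1..2 ^ k :: nat}). c v *\<^sub>R jt_unit v) \<le> 4 * sqrt (card A)"
proof -
  let ?B = "SIGMA k:A. {1..2 ^ k :: nat}"
  have fin: "finite ?B" using A by auto
  have "(\<Sum>v\<in>S \<inter> ?B. c v)\<^sup>2 \<le> 4\<^sup>2 * (\<Sum>v\<in>S \<inter> ?B. (1 / 2) ^ fst v)" if S: "tree_segment S" for S
  proof -
    have inj: "inj_on fst (S \<inter> ?B)"
      using tree_segment_inj_fst[OF S] by (auto simp: inj_on_def)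
    have "\<bar>\<Sum>v\<in>S \<inter> ?B. c v\<bar> \<le> (\<Sum>v\<in>S \<inter> ?B. (1 / sqrt 2) ^ fst v)"
      using c by (intro order_trans[OF sum_abs] sum_mono) auto
    hence "(\<Sum>v\<in>S \<inter> ?B. c v)\<^sup>2 \<le> (\<Sum>v\<in>S \<inter> ?B. (1 / sqrt 2) ^ fst v)\<^sup>2"
      by (rule abs_le_square_iff[THEN iffD1, OF order_trans[OF _ abs_ge_self]])
    also have "\<dots> = (\<Sum>k\<in>fst ` (S \<inter> ?B). (1 / sqrt 2) ^ k)\<^sup>2"
      using inj by (simp add: sum.reindex)
    also have "\<dots> \<le> 16 * (\<Sum>k\<in>fst ` (S \<inter> ?B). (1 / 2) ^ k)"
      using fin by (intro sum_inverse_sqrt_2_squared_le) auto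
    also have "\<dots> = 4\<^sup>2 * (\<Sum>v\<in>S \<inter> ?B. (1 / 2) ^ fst v)"
      using inj by (simp add: sum.reindex)
    finally show ?thesis .
  qed
  moreover have "?B \<subseteq> tree_nodes" by (auto simp: tree_nodes_def)
  ultimately have "norm (\<Sum>v\<in>?B. c v *\<^sub>R jt_unit v) \<le> 4 * sqrt (\<Sum>v\<in>?B. (1 / 2) ^ fst v)"
    using fin by (intro norm_sum_unit_le) auto
  also have "(\<Sum>v\<in>?B. (1 / 2 :: real) ^ fst v) = (\<Sum>k\<in>A. \<Sum>i=1..2 ^ k :: nat. (1 / 2) ^ k)"
    unfolding sum_Sigma_levels[OF A] by simp
  also have "\<dots> = card A" by (simp add: power_divide)
  finally show ?thesis .
qed

text \<open>In this scaling the estimate for a single level bounds the quantity by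
  \<open>norm y\<close>; the point is to find levels where it is small.\<close>

definition level_avg :: "(jt \<Rightarrow>\<^sub>L real) \<Rightarrow> nat \<Rightarrow> real" where
  "level_avg y k = (1 / sqrt 2) ^ k * (\<Sum>v\<in>level k. \<bar>blinfun_apply y (jt_unit v)\<bar>)"

text \<open>Testing \<open>y\<close> on one combination of unit vectors from all levels in
  \<open>A\<close>, with signs adapted to \<open>y\<close>, yields growth like the square root of
  \<open>card A\<close> instead of \<open>card A\<close>.\<close>

lemma sum_level_avg_le:
  assumes A: "finite A"
  shows "(\<Sum>k\<in>A. level_avg y k) \<le> 4 * norm y * sqrt (card A)"
proof -
  define c where "c v = sgn (blinfun_apply y (jt_unit v)) * (1 / sqrt 2) ^ fst v" for v :: "nat \<times> nat"
  let ?B = "SIGMA k:A. {1..2 ^ k :: nat}"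
  have "(\<Sum>k\<in>A. level_avg y k) = (\<Sum>v\<in>?B. c v * blinfun_apply y (jt_unit v))"
  proof -
    have "c v * blinfun_apply y (jt_unit v) = (1 / sqrt 2) ^ fst v * \<bar>blinfun_apply y (jt_unit v)\<bar>" for v
      by (simp add: c_def sgn_if)
    thus ?thesis
      by (simp only: sum_Sigma_levels[OF A] level_avg_def sum_level sum_distrib_left fst_conv)
  qed
  also have "\<dots> = blinfun_apply y (\<Sum>v\<in>?B. c v *\<^sub>R jt_unit v)"
    by (simp add: blinfun.sum_right blinfun.scaleR_right)
  also have "\<dots> \<le> norm y * norm (\<Sum>v\<in>?B. c v *\<^sub>R jt_unit v)"
    by (rule order_trans[OF abs_ge_self norm_blinfun[of y, unfolded real_norm_def]])
  also have "\<dots> \<le> norm y * (4 * sqrt (card A))"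
  proof (intro mult_left_mono norm_sum_unit_levels_le A)
    show "\<bar>c v\<bar> \<le> (1 / sqrt 2) ^ fst v" for v
      by (simp add: c_def abs_mult abs_sgn_eq)
  qed simp
  finally show ?thesis by simp
qed

text \<open>Otherwise \<open>N\<close> consecutive levels contribute at least
  \<open>\<eta> * N\<close> against the bound \<open>s * sqrt N\<close>, which fails once
  \<open>N\<close> exceeds the square of \<open>s / \<eta>\<close>.\<close>

lemma exists_level_avg_small:
  fixes y :: "'i \<Rightarrow> jt \<Rightarrow>\<^sub>L real"
  assumes "0 < \<eta>"
  shows "\<exists>k\<ge>K. (\<Sum>i\<in>I. level_avg (y i) k) < \<eta>"
proof (rule ccontr)
  assume "\<not> ?thesis"
  hence big: "\<eta> \<le> (\<Sum>i\<in>I. level_avg (y i) k)" if "K \<le> k" for k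
    using that by (auto simp: not_less)
  define s where "s = 4 * (\<Sum>i\<in>I. norm (y i))"
  obtain N :: nat where N: "(s / \<eta>)\<^sup>2 < N" using reals_Archimedean2 by blast
  hence N0: "0 < N" using zero_le_power2[of "s / \<eta>"] by (intro gr0I) simp
  let ?A = "{K..<K + N}"
  have "\<eta> * N = (\<Sum>k\<in>?A. \<eta>)" by simp
  also have "\<dots> \<le> (\<Sum>k\<in>?A. \<Sum>i\<in>I. level_avg (y i) k)"
    using big by (intro sum_mono) simp
  also have "\<dots> = (\<Sum>i\<in>I. \<Sum>k\<in>?A. level_avg (y i) k)" by (rule sum.swap)
  also have "\<dots> \<le> (\<Sum>i\<in>I. 4 * norm (y i) * sqrt (card ?A))"
    by (intro sum_mono sum_level_avg_le) simp
  also have "\<dots> = s * sqrt N"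
    by (simp add: s_def sum_distrib_left sum_distrib_right)
  finally have "\<eta> * sqrt N * sqrt N \<le> s * sqrt N" by (simp add: mult.assoc)
  hence "\<eta> * sqrt N \<le> s" using N0 by simp
  hence "sqrt N \<le> s / \<eta>" using assms by (simp add: field_simps)
  hence "N \<le> (s / \<eta>)\<^sup>2" by (rule sqrt_le_D)
  thus False using N by simp
qed

section \<open>Averages of branch functionals\<close>

text \<open>\<open>J\<close> is the identity of \<open>JT\<^sup>*\<close> or the inclusion of \<open>JT\<^sub>*\<close> into \<open>JT\<^sup>*\<close>.\<close>

locale jt_embedding =
  fixes J :: "'x::banach \<Rightarrow> jt \<Rightarrow>\<^sub>L real" and e :: "nat \<times> nat \<Rightarrow> 'x"
  assumes bounded_linear_J: "bounded_linear J"
    and norm_J: "norm (J x) = norm x"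
    and J_e: "J (e v) = jt_coord v"
begin

interpretation J: bounded_linear J by (rule bounded_linear_J)

definition desc_avg :: "nat \<times> nat \<Rightarrow> nat \<Rightarrow> 'x" where
  "desc_avg v j = (1 / 2) ^ j *\<^sub>R (\<Sum>w\<in>descendants j v. e w)"

text \<open>\<open>\<theta> v\<close> is the average, over all branches \<open>\<beta>\<close> through \<open>v\<close>, of the functionals that sum along \<open>\<beta>\<close>.
  It depends on \<open>v\<close> like a martingale, which makes the level means below increasing.\<close>

definition \<theta> :: "nat \<times> nat \<Rightarrow> 'x" where
  "\<theta> v = (\<Sum>w\<in>ancestors v. e w) + (\<Sum>j. desc_avg v j)"

text \<open>This is the unit vector of \<open>JT\<close> at \<open>v\<close>, acting on
  \<open>'x\<close> through \<open>J\<close>. Bounded linearity, which gives \<open>Blinfun\<close>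
  its meaning, is checked in \<open>unit_star_apply\<close>.\<close>

definition unit_star :: "nat \<times> nat \<Rightarrow> 'x \<Rightarrow>\<^sub>L real" where
  "unit_star v = Blinfun (\<lambda>x. blinfun_apply (J x) (jt_unit v))"

text \<open>The \<open>p\<close>-th power of the dominating function: with no root taken, it can be
  summed over families of functionals by exchanging sums.\<close>

definition level_mean :: "real \<Rightarrow> nat \<Rightarrow> ('x \<Rightarrow>\<^sub>L real) \<Rightarrow> real" where
  "level_mean p k x = (\<Sum>v\<in>level k. \<bar>blinfun_apply x (\<theta> v)\<bar> powr p) / 2 ^ k"

text \<open>Cauchy-Schwarz costs \<open>sqrt (2 ^ j)\<close> for the coordinates at
  \<open>2 ^ j\<close> nodes, and averaging divides by \<open>2 ^ j\<close>.\<close>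

lemma norm_desc_avg_le:
  assumes v: "v \<in> tree_nodes"
  shows "norm (desc_avg v j) \<le> (1 / sqrt 2) ^ j"
proof -
  have "norm (J (\<Sum>w\<in>descendants j v. e w)) \<le> sqrt (2 ^ j)"
  proof (rule norm_blinfun_bound)
    fix a
    have "blinfun_apply (J (\<Sum>w\<in>descendants j v. e w)) a = (\<Sum>w\<in>descendants j v. jt_apply a w)"
      by (simp add: J.sum J_e blinfun.sum_left jt_apply_eq_coord)
    thus "norm (blinfun_apply (J (\<Sum>w\<in>descendants j v. e w)) a) \<le> sqrt (2 ^ j) * norm a"
      using abs_sum_nodes_le[of "descendants j v" a] finite_descendants descendants_subset[OF v]
      by (simp add: card_descendants[OF v])
  qed simp
  hence "norm (desc_avg v j) \<le> (1 / 2) ^ j * sqrt 2 ^ j"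
    by (simp add: desc_avg_def norm_J real_sqrt_power)
  also have "\<dots> = (1 / sqrt 2) ^ j"
  proof -
    have "1 / 2 * sqrt 2 = 1 / sqrt 2" by (simp add: field_simps)
    thus ?thesis by (metis power_mult_distrib)
  qed
  finally show ?thesis .
qed

text \<open>Absolute convergence in the complete space \<open>'x\<close> is what places
  \<open>\<theta> v\<close> in the predual, and not only in its ambient dual.\<close>

lemma summable_desc_avg:
  assumes "v \<in> tree_nodes" shows "summable (desc_avg v)"
  by (rule summable_comparison_test'[OF suminf_inverse_sqrt_2(1)]) (rule norm_desc_avg_le[OF assms])

lemma norm_suminf_desc_avg_le:
  assumes "v \<in> tree_nodes" shows "norm (\<Sum>j. desc_avg v j) \<le> 4"
proof -
  have "norm (\<Sum>j. desc_avg v j) \<le> (\<Sum>j. (1 / sqrt 2 :: real) ^ j)"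
    by (rule norm_suminf_le[OF norm_desc_avg_le[OF assms] suminf_inverse_sqrt_2(1)])
  thus ?thesis using suminf_inverse_sqrt_2(2) by linarith
qed

text \<open>The ancestors form a segment and contribute 1; the geometric series contributes
  4.\<close>

lemma norm_theta_le:
  assumes v: "v \<in> tree_nodes" shows "norm (\<theta> v) \<le> 5"
proof -
  have "norm (J (\<Sum>w\<in>ancestors v. e w)) \<le> 1"
  proof (rule norm_blinfun_bound)
    fix a
    have "\<bar>\<Sum>w\<in>ancestors v. jt_apply a w\<bar> \<le> norm a"
      using abs_sum_segment_le[OF tree_segment_ancestors[OF v]] by (cases "ancestors v = {}") auto
    thus "norm (blinfun_apply (J (\<Sum>w\<in>ancestors v. e w)) a) \<le> 1 * norm a"
      by (simp add: J.sum J_e blinfun.sum_left jt_apply_eq_coord)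
  qed simp
  thus ?thesis
    using norm_triangle_ineq[of "\<Sum>w\<in>ancestors v. e w" "\<Sum>j. desc_avg v j"]
      norm_suminf_desc_avg_le[OF v] by (simp add: \<theta>_def norm_J)
qed

text \<open>Generation \<open>Suc j\<close> below \<open>v\<close> consists of generation
  \<open>j\<close> below its two children. The term \<open>desc_avg v 0 = e v\<close> lost in this
  shift returns because \<open>v\<close> joins the ancestors of both children.\<close>

lemma theta_children:
  assumes v: "v \<in> tree_nodes"
  shows "\<theta> (left_child v) + \<theta> (right_child v) = 2 *\<^sub>R \<theta> v"
proof -
  note c = children_in_tree_nodes[OF v]
  have "desc_avg v (Suc j) = (1 / 2) *\<^sub>R (desc_avg (left_child v) j + desc_avg (right_child v) j)" for j
    unfolding desc_avg_def sum_descendants_Suc[OF v] by (simp add: scaleR_add_right)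
  hence "(\<Sum>j. desc_avg v (Suc j)) =
      (1 / 2) *\<^sub>R ((\<Sum>j. desc_avg (left_child v) j) + (\<Sum>j. desc_avg (right_child v) j))"
    using summable_desc_avg[OF c(1)] summable_desc_avg[OF c(2)]
    by (simp add: suminf_scaleR_right[symmetric] suminf_add summable_add)
  moreover have "desc_avg v 0 = e v" by (simp add: desc_avg_def descendants_0[OF v])
  hence "(\<Sum>j. desc_avg v (Suc j)) = (\<Sum>j. desc_avg v j) - e v"
    using suminf_split_head[OF summable_desc_avg[OF v]] by simp
  ultimately have *: "(\<Sum>j. desc_avg (left_child v) j) + (\<Sum>j. desc_avg (right_child v) j) =
      2 *\<^sub>R ((\<Sum>j. desc_avg v j) - e v)"
    by simp
  have "\<theta> (left_child v) + \<theta> (right_child v) = 2 *\<^sub>R (e v + (\<Sum>w\<in>ancestors v. e w)) +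
      ((\<Sum>j. desc_avg (left_child v) j) + (\<Sum>j. desc_avg (right_child v) j))"
    by (simp add: \<theta>_def ancestors_children[OF v] finite_ancestors not_in_ancestors scaleR_2)
  thus ?thesis unfolding * by (simp add: \<theta>_def algebra_simps)
qed

lemma unit_star_apply: "blinfun_apply (unit_star v) x = blinfun_apply (J x) (jt_unit v)"
  unfolding unit_star_def
  by (subst bounded_linear_Blinfun_apply)
    (auto intro: bounded_linear_compose[OF blinfun.bounded_linear_left bounded_linear_J])

lemma unit_star_e:
  assumes "v \<in> tree_nodes" shows "blinfun_apply (unit_star v) (e w) = (if w = v then 1 else 0)"
  by (simp add: unit_star_apply J_e jt_coord_unit[OF assms])

text \<open>Among all terms of \<open>\<theta> v\<close> only \<open>desc_avg v 0\<close> involves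
  \<open>e v\<close>.\<close>

lemma unit_star_theta:
  assumes v: "v \<in> tree_nodes" shows "blinfun_apply (unit_star v) (\<theta> v) = 1"
proof -
  have "v \<notin> descendants (Suc j) v" for j
    by (cases v) (simp add: descendants_def)
  hence "blinfun_apply (unit_star v) (desc_avg v j) = (if j = 0 then 1 else 0)" for j
    using descendants_0[OF v]
    by (cases j) (auto simp: desc_avg_def blinfun.sum_right blinfun.scaleR_right unit_star_e[OF v]
        finite_descendants)
  moreover have "blinfun_apply (unit_star v) (\<Sum>j. desc_avg v j) =
      (\<Sum>j. blinfun_apply (unit_star v) (desc_avg v j))"
    by (rule bounded_linear.suminf[OF blinfun.bounded_linear_right summable_desc_avg[OF v]])
  moreover have "(\<Sum>j. if j = 0 then 1 else 0 :: real) = 1"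
    by (subst suminf_finite[of "{0}"]) auto
  ultimately show ?thesis
    by (simp add: \<theta>_def blinfun.add_right blinfun.sum_right unit_star_e[OF v] finite_ancestors
        not_in_ancestors)
qed

lemma norm_sum_unit_star_le:
  "norm (\<Sum>v\<in>level k. c v *\<^sub>R unit_star v) \<le> sqrt (\<Sum>v\<in>level k. (c v)\<^sup>2)"
proof (rule norm_blinfun_bound)
  fix x
  have "norm (blinfun_apply (\<Sum>v\<in>level k. c v *\<^sub>R unit_star v) x) =
      norm (blinfun_apply (J x) (\<Sum>v\<in>level k. c v *\<^sub>R jt_unit v))"
    by (simp add: blinfun.sum_left blinfun.sum_right blinfun.scaleR_left blinfun.scaleR_right
        unit_star_apply)
  also have "\<dots> \<le> norm x * sqrt (\<Sum>v\<in>level k. (c v)\<^sup>2)"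
    by (rule order_trans[OF norm_blinfun[of "J x", unfolded norm_J]])
      (intro mult_left_mono norm_sum_unit_level_le norm_ge_zero)
  finally show "norm (blinfun_apply (\<Sum>v\<in>level k. c v *\<^sub>R unit_star v) x) \<le>
      sqrt (\<Sum>v\<in>level k. (c v)\<^sup>2) * norm x" by (simp add: mult.commute)
qed (simp add: sum_nonneg)

end

lemma powr_mean_le:
  fixes a b :: real
  assumes p: "1 \<le> p"
  shows "\<bar>(a + b) / 2\<bar> powr p \<le> (\<bar>a\<bar> powr p + \<bar>b\<bar> powr p) / 2"
proof -
  have "\<bar>(a + b) / 2\<bar> powr p \<le> ((\<bar>a\<bar> + \<bar>b\<bar>) / 2) powr p"
    using p by (intro powr_mono2) auto
  also have "\<dots> \<le> (\<bar>a\<bar> powr p + \<bar>b\<bar> powr p) / 2"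
  \<comment> \<open>Convexity is invoked at positive points only; a zero argument leaves an
    inequality between \<open>(x / 2) powr p\<close> and \<open>x powr p / 2\<close>.\<close>
  proof (cases "a = 0 \<or> b = 0")
    case True
    have "(x / 2) powr p \<le> x powr p / 2" if "0 \<le> x" for x :: real
    proof -
      have "x powr p * (1 / 2) powr p \<le> x powr p * (1 / 2) powr 1"
        using p by (intro mult_left_mono powr_mono') auto
      thus ?thesis using that by (simp add: powr_divide)
    qed
    thus ?thesis using True by auto
  next
    case False
    thus ?thesis
      using convex_onD[OF powr_convex[OF p], of "1/2" "\<bar>a\<bar>" "\<bar>b\<bar>"] by (simp add: add_divide_distrib)
  qed
  finally show ?thesis .
qed

section \<open>Level means and the functions dominated by them\<close>

context jt_embedding
begin

text \<open>By \<open>theta_children\<close> the value at a node is the mean of the values at its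
  children, so convexity of the \<open>p\<close>-th power makes the level means grow.\<close>

lemma mono_level_mean:
  assumes p: "1 \<le> p" shows "mono (\<lambda>k. level_mean p k x)"
proof (rule incseq_SucI)
  fix k
  let ?f = "\<lambda>v. \<bar>blinfun_apply x (\<theta> v)\<bar> powr p"
  have "2 * ?f v \<le> ?f (left_child v) + ?f (right_child v)" if "v \<in> level k" for v
  proof -
    have v: "v \<in> tree_nodes" using that level_subset by blast
    have "blinfun_apply x (\<theta> (left_child v)) + blinfun_apply x (\<theta> (right_child v)) =
        2 * blinfun_apply x (\<theta> v)"
      by (simp add: theta_children[OF v] blinfun.scaleR_right flip: blinfun.add_right)
    thus ?thesis
      using powr_mean_le[OF p, of "blinfun_apply x (\<theta> (left_child v))"
          "blinfun_apply x (\<theta> (right_child v))"] by simp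
  qed
  hence "2 * sum ?f (level k) \<le> sum ?f (level (Suc k))"
    unfolding sum_level_Suc sum_distrib_left by (rule sum_mono)
  thus "level_mean p k x \<le> level_mean p (Suc k) x"
    by (simp add: level_mean_def field_simps)
qed

text \<open>Summing over \<open>i\<close> first, every node satisfies the same bound because
  \<open>\<theta> v\<close> has norm at most 5, and the mean over the level keeps it.\<close>

lemma sum_level_mean_le:
  assumes p: "1 < p"
  shows "(\<Sum>i<n. level_mean p k (x i)) \<le> (5 * weak_lp_norm p n x) powr p"
proof -
  have "(\<Sum>i<n. level_mean p k (x i)) =
      (\<Sum>v\<in>level k. \<Sum>i<n. \<bar>blinfun_apply (x i) (\<theta> v)\<bar> powr p) / 2 ^ k"
    unfolding level_mean_def sum_divide_distrib by (rule sum.swap)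
  also have "\<dots> \<le> (\<Sum>v\<in>level k. (5 * weak_lp_norm p n x) powr p) / 2 ^ k"
  proof (intro divide_right_mono sum_mono)
    fix v assume "v \<in> level k"
    hence "norm (\<theta> v) * weak_lp_norm p n x \<le> 5 * weak_lp_norm p n x"
      using level_subset weak_lp_norm_nonneg[OF p] by (intro mult_right_mono norm_theta_le) auto
    hence "(norm (\<theta> v) * weak_lp_norm p n x) powr p \<le> (5 * weak_lp_norm p n x) powr p"
      using p weak_lp_norm_nonneg[OF p, of n x] by (intro powr_mono2) auto
    thus "(\<Sum>i<n. \<bar>blinfun_apply (x i) (\<theta> v)\<bar> powr p) \<le> (5 * weak_lp_norm p n x) powr p"
      using sum_eval_powr_le[OF p, where n = n and x = x and y = "\<theta> v"] by linarith
  qed simp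
  also have "\<dots> = (5 * weak_lp_norm p n x) powr p" by (simp add: card_level)
  finally show ?thesis .
qed

text \<open>One level \<open>k\<close> serves all \<open>x\<close> but may depend on
  \<open>f\<close>; by monotonicity it can always be raised. Small \<open>d\<close> serves the Fatou
  property, \<open>d = 1\<close> monotone boundedness.\<close>

definition mean_bounded :: "real \<Rightarrow> real \<Rightarrow> (('x \<Rightarrow>\<^sub>L real) \<Rightarrow> real) set" where
  "mean_bounded p d = {f \<in> FVL. (\<lambda>_. 0) \<le> f \<and> (\<exists>k. \<forall>x. f x powr p \<le> d powr p * level_mean p k x)}"

lemma p_norm_mean_bounded_le:
  assumes p: "1 < p" and d: "0 \<le> d" and f: "f \<in> mean_bounded p d"
  shows "p_norm p f \<le> ennreal (5 * d)"
proof (rule p_norm_le[OF p])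
  fix n and x :: "nat \<Rightarrow> 'x \<Rightarrow>\<^sub>L real"
  obtain k where k: "\<And>x. f x powr p \<le> d powr p * level_mean p k x" and f0: "\<And>x. 0 \<le> f x"
    using f by (auto simp: mean_bounded_def le_fun_def)
  have "(\<Sum>i<n. \<bar>f (x i)\<bar> powr p) \<le> d powr p * (\<Sum>i<n. level_mean p k (x i))"
    unfolding sum_distrib_left using k f0 by (intro sum_mono) simp
  also have "\<dots> \<le> d powr p * (5 * weak_lp_norm p n x) powr p"
    by (intro mult_left_mono sum_level_mean_le p) simp
  also have "\<dots> = (5 * d * weak_lp_norm p n x) powr p"
    using d weak_lp_norm_nonneg[OF p, of n x] by (simp add: powr_mult mult_ac)
  finally show "(\<Sum>i<n. \<bar>f (x i)\<bar> powr p) \<le> (5 * d * weak_lp_norm p n x) powr p" .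
qed (use d in simp)

text \<open>Both bounds hold at level \<open>max k l\<close>, and a maximum stays below a common
  bound, so directedness costs no increase of \<open>d\<close>.\<close>

lemma mean_bounded_sup:
  assumes p: "1 \<le> p" and f: "f \<in> mean_bounded p d" and g: "g \<in> mean_bounded p d"
  shows "sup f g \<in> mean_bounded p d"
proof -
  obtain k l where k: "\<And>x. f x powr p \<le> d powr p * level_mean p k x"
    and l: "\<And>x. g x powr p \<le> d powr p * level_mean p l x"
    using f g by (auto simp: mean_bounded_def)
  have "sup f g x powr p \<le> d powr p * level_mean p (max k l) x" for x
  proof -
    have "level_mean p k x \<le> level_mean p (max k l) x" "level_mean p l x \<le> level_mean p (max k l) x"
      using monoD[OF mono_level_mean[OF p]] by auto
    from mult_left_mono[OF this(1), of "d powr p"] mult_left_mono[OF this(2), of "d powr p"]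
      k[of x] l[of x]
    show ?thesis by (auto simp: sup_max max_def)
  qed
  moreover have "sup f g \<in> FVL"
    using f g by (auto simp: mean_bounded_def intro: FVL_sup)
  moreover have "(\<lambda>_. 0) \<le> sup f g"
    using f by (auto simp: mean_bounded_def le_fun_def sup_max le_max_iff_disj)
  ultimately show ?thesis by (auto simp: mean_bounded_def)
qed

text \<open>For \<open>0 < p\<close> and \<open>0 \<le> d\<close> the scaling makes the
  \<open>p\<close>-th power equal to \<open>d powr p\<close> times a single summand of the level
  mean.\<close>

definition theta_fun :: "real \<Rightarrow> real \<Rightarrow> nat \<times> nat \<Rightarrow> ('x \<Rightarrow>\<^sub>L real) \<Rightarrow> real" where
  "theta_fun p d v x = d * 2 powr (- real (fst v) / p) * \<bar>blinfun_apply x (\<theta> v)\<bar>"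

lemma theta_fun_powr_le:
  assumes p: "0 < p" and d: "0 \<le> d" and v: "v \<in> tree_nodes"
  shows "theta_fun p d v x powr p \<le> d powr p * level_mean p (fst v) x"
proof -
  have "\<bar>blinfun_apply x (\<theta> v)\<bar> powr p \<le> (\<Sum>v\<in>level (fst v). \<bar>blinfun_apply x (\<theta> v)\<bar> powr p)"
    using v finite_level by (intro member_le_sum) (auto simp: tree_nodes_iff_level)
  hence "\<bar>blinfun_apply x (\<theta> v)\<bar> powr p / 2 ^ fst v \<le> level_mean p (fst v) x"
    unfolding level_mean_def by (rule divide_right_mono) simp
  hence "d powr p * (\<bar>blinfun_apply x (\<theta> v)\<bar> powr p / 2 ^ fst v) \<le> d powr p * level_mean p (fst v) x"
    by (rule mult_left_mono) simp
  moreover have "- real (fst v) / p * p = - real (fst v)" using p by simp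
  hence "(2 powr (- real (fst v) / p)) powr p = 1 / 2 ^ fst v"
    by (simp only: powr_powr) (simp add: powr_minus powr_realpow divide_inverse)
  hence "theta_fun p d v x powr p = d powr p * (\<bar>blinfun_apply x (\<theta> v)\<bar> powr p / 2 ^ fst v)"
    using p d by (simp add: theta_fun_def powr_mult)
  ultimately show ?thesis by simp
qed

lemma theta_fun_in_FVL: "theta_fun p d v \<in> FVL"
proof -
  have "(\<lambda>x. \<bar>eval_at (\<theta> v) x\<bar>) \<in> FVL"
    by (rule vector_sublattice_abs[OF vector_sublattice_FVL eval_at_in_FVL])
  hence "(\<lambda>x. d * 2 powr (- real (fst v) / p) * \<bar>eval_at (\<theta> v) x\<bar>) \<in> FVL"
    by (rule FVL_scale)
  thus ?thesis by (simp add: theta_fun_def[abs_def] eval_at_def)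
qed

lemma theta_fun_mean_bounded:
  assumes "0 < p" "0 \<le> d" "v \<in> tree_nodes"
  shows "theta_fun p d v \<in> mean_bounded p d"
proof -
  have "(\<lambda>_. 0) \<le> theta_fun p d v"
    using assms(2) by (simp add: le_fun_def theta_fun_def)
  thus ?thesis
    unfolding mean_bounded_def using theta_fun_powr_le[OF assms] theta_fun_in_FVL by blast
qed

lemma inf_mean_bounded:
  assumes p: "0 \<le> p" and f: "f \<in> mean_bounded p d" and g: "g \<in> FVL" "(\<lambda>_. 0) \<le> g"
  shows "inf g f \<in> mean_bounded p d"
proof -
  obtain k where k: "\<And>x. f x powr p \<le> d powr p * level_mean p k x" and f0: "\<And>x. 0 \<le> f x"
    using f by (auto simp: mean_bounded_def le_fun_def)
  have "inf g f x powr p \<le> d powr p * level_mean p k x" for x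
  proof -
    have "inf g f x powr p \<le> f x powr p"
      using f0[of x] g(2) p by (intro powr_mono2) (auto simp: inf_min le_fun_def)
    thus ?thesis using k[of x] by linarith
  qed
  moreover have "inf g f \<in> FVL"
    using f g by (auto simp: mean_bounded_def intro: FVL_inf)
  ultimately show ?thesis using f0 g by (auto simp: mean_bounded_def le_fun_def inf_min)
qed

end

section \<open>Test vectors\<close>

text \<open>Hoelder's inequality against \<open>n\<close> ones, obtained by summing Young's
  inequality.\<close>

lemma sum_abs_le_of_lp_norm_le_1:
  assumes p: "1 < p" and a: "lp_norm (conj_exponent p) n a \<le> 1"
  shows "(\<Sum>i<n. \<bar>a i\<bar>) \<le> n powr (1 / p)"
proof (cases "n = 0")
  case False
  define q where "q = conj_exponent p"
  have q: "1 < q" "1 / q + 1 / p = 1"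
    using p conj_exponent_gt_1[OF p] by (auto simp: q_def conj_exponent_def field_simps)
  \<comment> \<open>Normalised so that \<open>n * b powr p = 1\<close>; the sum of the Young bounds
    is then at most \<open>1 / q + 1 / p = 1\<close>.\<close>
  define b where "b = n powr (- 1 / p)"
  have "b powr p = 1 / n"
  proof -
    have "- 1 / p * p = - 1" using p by simp
    thus ?thesis using False by (simp only: b_def powr_powr) (simp add: powr_minus divide_inverse)
  qed
  hence "\<bar>a i\<bar> * b \<le> \<bar>a i\<bar> powr q / q + 1 / n / p" for i
    using Youngs_inequality[OF q(1) p q(2), of "\<bar>a i\<bar>" b] by (simp add: b_def)
  hence "(\<Sum>i<n. \<bar>a i\<bar> * b) \<le> (\<Sum>i<n. \<bar>a i\<bar> powr q / q + 1 / n / p)"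
    by (rule sum_mono)
  also have "\<dots> = (\<Sum>i<n. \<bar>a i\<bar> powr q) / q + 1 / p"
    using False by (simp add: sum.distrib sum_divide_distrib)
  also have "\<dots> \<le> 1 / q + 1 / p"
    using a q(1) lp_norm_le_iff[of q 1 n a] by (intro add_right_mono divide_right_mono) (auto simp: q_def)
  finally have "(\<Sum>i<n. \<bar>a i\<bar>) * b \<le> 1" using q(2) by (simp add: sum_distrib_right)
  moreover have "b * n powr (1 / p) = 1"
    using False by (simp add: b_def flip: powr_add)
  hence "b = 1 / n powr (1 / p)" using False by (simp add: field_simps)
  ultimately show ?thesis using False by (simp add: field_simps)
qed simp

text \<open>Here \<open>2 \<le> p\<close> enters: the conjugate exponent is at most 2, and for
  numbers of modulus at most 1 the larger exponent gives the smaller power.\<close>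

lemma sum_squares_le_of_lp_norm_le_1:
  assumes p: "2 \<le> p" and a: "lp_norm (conj_exponent p) n a \<le> 1"
  shows "(\<Sum>i<n. (a i)\<^sup>2) \<le> 1"
proof -
  define q where "q = conj_exponent p"
  have q: "1 < q" "q \<le> 2"
    using p conj_exponent_gt_1[of p] conj_exponent_le_2[of p] by (auto simp: q_def)
  have "(a i)\<^sup>2 \<le> \<bar>a i\<bar> powr q" if "i < n" for i
  proof -
    have "\<bar>a i\<bar> powr 2 \<le> \<bar>a i\<bar> powr q"
      using lp_norm_le_1_imp_coord[OF _ a that] q by (intro powr_mono') (auto simp: q_def)
    thus ?thesis by simp
  qed
  hence "(\<Sum>i<n. (a i)\<^sup>2) \<le> (\<Sum>i<n. \<bar>a i\<bar> powr q)" by (intro sum_mono) auto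
  also have "\<dots> \<le> 1"
    using a q lp_norm_le_iff[of q 1 n a] by (simp add: q_def)
  finally show ?thesis .
qed

context jt_embedding
begin

lemma norm_sum_unit_star_inj_le:
  assumes h: "inj_on h {..<n}" "h ` {..<n} \<subseteq> level k"
  shows "norm (\<Sum>i<n. a i *\<^sub>R unit_star (h i)) \<le> sqrt (\<Sum>i<n. (a i)\<^sup>2)"
proof -
  define c where "c v = (if v \<in> h ` {..<n} then a (the_inv_into {..<n} h v) else 0)" for v
  have c: "c (h i) = a i" if "i < n" for i
    using that h(1) by (simp add: c_def the_inv_into_f_f)
  have "(\<Sum>v\<in>level k. c v *\<^sub>R unit_star v) = (\<Sum>v\<in>h ` {..<n}. c v *\<^sub>R unit_star v)"
    using h(2) finite_level by (intro sum.mono_neutral_right) (auto simp: c_def)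
  moreover have "(\<Sum>v\<in>level k. (c v)\<^sup>2) = (\<Sum>v\<in>h ` {..<n}. (c v)\<^sup>2)"
    using h(2) finite_level by (intro sum.mono_neutral_right) (auto simp: c_def)
  ultimately show ?thesis
    using norm_sum_unit_star_le[of c k] h(1) by (simp add: sum.reindex c)
qed

text \<open>The common vector \<open>x\<close> is charged with the sum of the moduli of the
  coefficients, the distinct unit functionals only with their Euclidean norm.\<close>

lemma weak_lp_norm_test_le:
  assumes p: "2 \<le> p" and t: "0 \<le> t" and h: "inj_on h {..<n}" "h ` {..<n} \<subseteq> level k"
  shows "weak_lp_norm p n (\<lambda>i. x + t *\<^sub>R unit_star (h i)) \<le> n powr (1 / p) * norm x + t"
proof (rule weak_lp_norm_least)
  fix a :: "nat \<Rightarrow> real" assume a: "lp_norm (conj_exponent p) n a \<le> 1"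
  have "(\<Sum>i<n. a i *\<^sub>R (x + t *\<^sub>R unit_star (h i))) =
      (\<Sum>i<n. a i) *\<^sub>R x + t *\<^sub>R (\<Sum>i<n. a i *\<^sub>R unit_star (h i))"
    by (simp add: scaleR_add_right sum.distrib scaleR_sum_left scaleR_sum_right mult.commute)
  hence "norm (\<Sum>i<n. a i *\<^sub>R (x + t *\<^sub>R unit_star (h i))) \<le>
      \<bar>\<Sum>i<n. a i\<bar> * norm x + t * norm (\<Sum>i<n. a i *\<^sub>R unit_star (h i))"
    using norm_triangle_ineq[of "(\<Sum>i<n. a i) *\<^sub>R x" "t *\<^sub>R (\<Sum>i<n. a i *\<^sub>R unit_star (h i))"] t by simp
  also have "\<dots> \<le> n powr (1 / p) * norm x + t * 1"
  proof (intro add_mono mult_right_mono mult_left_mono)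
    show "\<bar>\<Sum>i<n. a i\<bar> \<le> n powr (1 / p)"
      by (rule order_trans[OF sum_abs sum_abs_le_of_lp_norm_le_1[OF _ a]]) (use p in simp)
    have "sqrt (\<Sum>i<n. (a i)\<^sup>2) \<le> 1"
      using sum_squares_le_of_lp_norm_le_1[OF p a] by simp
    thus "norm (\<Sum>i<n. a i *\<^sub>R unit_star (h i)) \<le> 1"
      using norm_sum_unit_star_inj_le[OF h, of a] by linarith
  qed (use t in auto)
  finally show "norm (\<Sum>i<n. a i *\<^sub>R (x + t *\<^sub>R unit_star (h i))) \<le> n powr (1 / p) * norm x + t" by simp
qed

text \<open>Markov's inequality on a level where the averages of all \<open>J y\<close>,
  \<open>y \<in> F\<close>, add up to less than \<open>\<eta> / 2\<close>: fewer than half of the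
  nodes can exceed the threshold.\<close>

lemma exists_level_mostly_small:
  fixes F :: "'x set"
  assumes "0 < \<eta>"
  obtains k W where "K \<le> k" "W \<subseteq> level k" "2 ^ k \<le> 2 * card W"
    "\<And>v. v \<in> W \<Longrightarrow> (\<Sum>y\<in>F. \<bar>blinfun_apply (unit_star v) y\<bar>) \<le> \<eta> * (1 / sqrt 2) ^ k"
proof -
  define s where "s v = (\<Sum>y\<in>F. \<bar>blinfun_apply (unit_star v) y\<bar>)" for v
  obtain k where k: "K \<le> k" "(\<Sum>y\<in>F. level_avg (J y) k) < \<eta> / 2"
    using exists_level_avg_small[of "\<eta> / 2" K J F] assms by auto
  define r where "r = (1 / sqrt 2 :: real) ^ k"
  have r: "0 < r" "r * r = 1 / 2 ^ k"
    using sqrt_half_power[of k] by (auto simp: r_def power2_eq_square power_divide)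
  let ?W = "{v \<in> level k. s v \<le> \<eta> * r}"
  have "(\<Sum>y\<in>F. level_avg (J y) k) = r * (\<Sum>v\<in>level k. s v)"
    unfolding level_avg_def s_def unit_star_apply r_def sum_distrib_left by (rule sum.swap)
  hence lt: "r * (\<Sum>v\<in>level k. s v) < \<eta> / 2" using k by simp
  have "card (level k - ?W) * (\<eta> * r) = (\<Sum>v\<in>level k - ?W. \<eta> * r)" by simp
  also have "\<dots> \<le> (\<Sum>v\<in>level k - ?W. s v)" by (rule sum_mono) auto
  also have "\<dots> \<le> (\<Sum>v\<in>level k. s v)"
    by (rule sum_mono2[OF finite_level]) (auto simp: s_def sum_nonneg)
  finally have "r * (card (level k - ?W) * (\<eta> * r)) \<le> r * (\<Sum>v\<in>level k. s v)"
    using r by (intro mult_left_mono) auto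
  with lt have "r * (card (level k - ?W) * (\<eta> * r)) < \<eta> / 2" by linarith
  hence "\<eta> * (card (level k - ?W) * (r * r)) < \<eta> * (1 / 2)" by (simp add: mult_ac)
  hence "card (level k - ?W) * (r * r) < 1 / 2" using assms by (simp only: mult_less_cancel_left_pos)
  hence "2 * real (card (level k - ?W)) < 2 ^ k" by (simp add: r field_simps)
  hence "2 * card (level k - ?W) < 2 ^ k"
    by (simp flip: of_nat_less_iff[where 'a = real])
  moreover have "card (level k - ?W) = card (level k) - card ?W"
    using finite_level by (intro card_Diff_subset) auto
  ultimately have W2: "2 ^ k \<le> 2 * card ?W" by (simp add: card_level)
  have small: "(\<Sum>y\<in>F. \<bar>blinfun_apply (unit_star v) y\<bar>) \<le> \<eta> * (1 / sqrt 2) ^ k" if "v \<in> ?W" for v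
    using that unfolding s_def r_def by simp
  have "?W \<subseteq> level k" by blast
  thus ?thesis by (rule that[OF k(1) _ W2 small])
qed

text \<open>The test vectors \<open>x + M 2\<^sup>k\<^sup>/\<^sup>p e\<^sub>v\<^sup>*\<close>, with \<open>v\<close> in level \<open>k\<close>, have weak \<open>p\<close>-norm of the same order
  \<open>2\<^sup>k\<^sup>/\<^sup>p\<close> as the \<open>p\<close>-norm of a constant on them, and most of them are not seen by the finitely many
  elements of \<open>F\<close> on which \<open>w\<close> depends.\<close>

lemma test_vector_bound:
  fixes u w :: "('x \<Rightarrow>\<^sub>L real) \<Rightarrow> real"
  assumes p: "2 \<le> p" and C: "0 \<le> C" and M: "0 \<le> M" and eps: "0 \<le> \<epsilon>"
    and w: "\<And>x'. \<bar>w x' - b\<bar> \<le> C * (\<Sum>y\<in>F. \<bar>blinfun_apply x' y - blinfun_apply x y\<bar>)"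
    and close: "\<And>n z. lp_norm p n (\<lambda>i. u (z i) - w (z i)) \<le> \<epsilon> * weak_lp_norm p n z"
    and large: "\<And>k v. K \<le> k \<Longrightarrow> v \<in> level k \<Longrightarrow> B \<le> u (x + (M * 2 powr (k / p)) *\<^sub>R unit_star v)"
  shows "B - b \<le> \<epsilon> * (norm x + 2 * M)"
proof (rule field_le_epsilon)
  fix d :: real assume d: "0 < d"
  \<comment> \<open>Makes the variation \<open>C * M * \<eta>\<close> of \<open>w\<close> at most
    \<open>d\<close>; the added 1 keeps the denominator positive.\<close>
  define \<eta> where "\<eta> = d / (C * M + 1)"
  have CM: "0 \<le> C * M" using C M by simp
  hence \<eta>: "0 < \<eta>" "C * M * \<eta> \<le> d"
    using d by (auto simp: \<eta>_def field_simps)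
  obtain k W where k: "K \<le> k" "W \<subseteq> level k" "2 ^ k \<le> 2 * card W"
    and W: "\<And>v. v \<in> W \<Longrightarrow> (\<Sum>y\<in>F. \<bar>blinfun_apply (unit_star v) y\<bar>) \<le> \<eta> * (1 / sqrt 2) ^ k"
    using exists_level_mostly_small[OF \<eta>(1)] by blast
  define t where "t = M * 2 powr (k / p)"
  have t: "0 \<le> t" using M by (simp add: t_def)
  have fin: "finite W" using k(2) finite_level finite_subset by blast
  define n where "n = card W"
  have n: "2 ^ k \<le> 2 * real n" using k(3) by (metis n_def of_nat_le_iff of_nat_mult of_nat_numeral of_nat_power)
  have n0: "0 < n" using k(3) by (cases "card W") (auto simp: n_def)
  obtain h where h: "bij_betw h {..<n} W"
    using ex_bij_betw_nat_finite[OF fin] by (auto simp: n_def atLeast0LessThan)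
  define z where "z i = x + t *\<^sub>R unit_star (h i)" for i
  define c where "c = B - b - d"
  have c: "c \<le> u (z i) - w (z i)" if "i < n" for i
  proof -
    have hi: "h i \<in> W" using h that by (auto simp: bij_betw_def)
    have "\<bar>w (z i) - b\<bar> \<le> C * (\<Sum>y\<in>F. \<bar>blinfun_apply (z i) y - blinfun_apply x y\<bar>)" by (rule w)
    also have "\<dots> = C * t * (\<Sum>y\<in>F. \<bar>blinfun_apply (unit_star (h i)) y\<bar>)"
      using t by (simp add: z_def blinfun.add_left blinfun.scaleR_left abs_mult sum_distrib_left mult.assoc)
    also have "\<dots> \<le> C * t * (\<eta> * (1 / sqrt 2) ^ k)"
      using W[OF hi] C t by (intro mult_left_mono) auto
    also have "\<dots> = C * M * \<eta> * (2 powr (k / p) * (1 / sqrt 2) ^ k)" by (simp add: t_def)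
    also have "\<dots> \<le> C * M * \<eta> * 1"
    proof (intro mult_left_mono)
      \<comment> \<open>Again \<open>2 \<le> p\<close>: the length of the perturbation is outweighed
        by the smallness of the evaluations on \<open>W\<close>.\<close>
      have "2 powr (k / p) \<le> 2 powr (1 / 2 * k)"
        using divide_left_mono[of 2 p "real k"] p by (intro powr_mono) auto
      also have "\<dots> = sqrt 2 ^ k"
        by (simp only: powr_powr[symmetric]) (simp add: powr_half_sqrt powr_realpow)
      finally show "2 powr (k / p) * (1 / sqrt 2) ^ k \<le> 1" by (simp add: power_divide)
    qed (use CM \<eta> in auto)
    finally have "\<bar>w (z i) - b\<bar> \<le> d" using \<eta> by simp
    moreover have "B \<le> u (z i)"
      unfolding z_def t_def using k hi by (intro large) auto
    ultimately show ?thesis by (simp add: c_def)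
  qed
  have "c \<le> \<epsilon> * (norm x + 2 * M)"
  proof (cases "c \<le> 0")
    case True
    have "0 \<le> \<epsilon> * (norm x + 2 * M)" using eps M by simp
    thus ?thesis using True by linarith
  next
    case False
    \<comment> \<open>All \<open>n\<close> differences are at least the positive number
      \<open>c\<close>. The factor \<open>n powr (1 / p)\<close> will appear on both sides and
      cancel.\<close>
    have "n powr (1 / p) * c = (n * c powr p) powr (1 / p)"
      using p False by (simp add: powr_mult powr_powr)
    also have "\<dots> \<le> lp_norm p n (\<lambda>i. u (z i) - w (z i))"
    proof -
      have "(\<Sum>i<n. c powr p) \<le> (\<Sum>i<n. \<bar>u (z i) - w (z i)\<bar> powr p)"
      proof (rule sum_mono)
        fix i assume "i \<in> {..<n}"
        hence "c \<le> \<bar>u (z i) - w (z i)\<bar>" using c[of i] by simp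
        thus "c powr p \<le> \<bar>u (z i) - w (z i)\<bar> powr p"
          using p False by (intro powr_mono2) auto
      qed
      thus ?thesis unfolding lp_norm_def using p by (intro powr_mono2) auto
    qed
    also have "\<dots> \<le> \<epsilon> * weak_lp_norm p n z" by (rule close)
    also have "\<dots> \<le> \<epsilon> * (n powr (1 / p) * norm x + t)"
      unfolding z_def using p t h k(2) eps
      by (intro mult_left_mono weak_lp_norm_test_le) (auto simp: bij_betw_def)
    also have "\<dots> \<le> \<epsilon> * (n powr (1 / p) * norm x + M * (2 * n powr (1 / p)))"
    proof -
      \<comment> \<open>Since \<open>W\<close> holds at least half of the level,
        \<open>2 ^ k\<close> is at most \<open>2 * n\<close>, and the root turns this into a factor
        of at most 2.\<close>
      have "2 powr (k / p) = (2 ^ k) powr (1 / p)"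
        by (simp add: powr_powr flip: powr_realpow)
      also have "\<dots> \<le> (2 * real n) powr (1 / p)" using n p by (intro powr_mono2) auto
      also have "\<dots> = 2 powr (1 / p) * n powr (1 / p)" by (simp add: powr_mult)
      also have "\<dots> \<le> 2 powr 1 * n powr (1 / p)"
        using p by (intro mult_right_mono powr_mono) auto
      finally show ?thesis unfolding t_def using M eps by (intro mult_left_mono add_left_mono) auto
    qed
    finally have "n powr (1 / p) * c \<le> n powr (1 / p) * (\<epsilon> * (norm x + 2 * M))"
      by (simp add: algebra_simps)
    thus ?thesis using n0 by (simp add: mult_le_cancel_left_pos)
  qed
  thus "B - b \<le> \<epsilon> * (norm x + 2 * M) + d" by (simp add: c_def)
qed

section \<open>Failure of the Fatou property and of monotone boundedness\<close>

abbreviation root_node :: "nat \<times> nat" where "root_node \<equiv> (0, 1)"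

abbreviation root_fun :: "('x \<Rightarrow>\<^sub>L real) \<Rightarrow> real" where
  "root_fun \<equiv> \<lambda>x. \<bar>eval_at (e root_node) x\<bar>"

lemma root_fun_in_FVL: "root_fun \<in> FVL"
  by (rule vector_sublattice_abs[OF vector_sublattice_FVL eval_at_in_FVL])

text \<open>Moving \<open>x\<close> along \<open>unit_star v\<close>, with \<open>v\<close> below
  the root, keeps \<open>root_fun\<close> fixed but makes \<open>theta_fun p d v\<close> exceed it.
  The infimum of both then forces \<open>u\<close> to be at least \<open>root_fun x\<close> there,
  and \<open>test_vector_bound\<close> carries this back to \<open>x\<close>.\<close>

lemma root_fun_le_upper_bound:
  assumes p: "2 \<le> p" and d: "0 < d" and u: "u \<in> Hp_closure p FVL"
    and ub: "\<And>f. f \<in> mean_bounded p d \<Longrightarrow> f \<le> root_fun \<Longrightarrow> f \<le> u"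
  shows "root_fun \<le> u"
proof (rule le_funI)
  fix x
  \<comment> \<open>The first summand absorbs the value of \<open>x\<close> at
    \<open>\<theta> v\<close>; the second still leaves \<open>root_fun x\<close> after
    multiplication by \<open>d\<close>.\<close>
  define M where "M = 5 * norm x + root_fun x / d"
  have M: "0 \<le> M" using d by (simp add: M_def)
  \<comment> \<open>Level 0 is excluded: its node is the root, where the perturbation would change
    \<open>root_fun\<close>.\<close>
  have large: "root_fun x \<le> u (x + (M * 2 powr (k / p)) *\<^sub>R unit_star v)"
    if k: "1 \<le> k" and v: "v \<in> level k" for k v
  proof -
    define z where "z = x + (M * 2 powr (k / p)) *\<^sub>R unit_star v"
    have vn: "v \<in> tree_nodes" and fst: "fst v = k" using v level_subset by (auto simp: level_def)
    have "inf root_fun (theta_fun p d v) \<in> mean_bounded p d"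
      using p d vn root_fun_in_FVL
      by (intro inf_mean_bounded theta_fun_mean_bounded) (auto simp: le_fun_def)
    from le_funD[OF ub[OF this inf_le1], of z]
    have "min (root_fun z) (theta_fun p d v z) \<le> u z"
      by (simp add: inf_min)
    moreover have "root_fun z = root_fun x"
      using k fst by (auto simp: z_def eval_at_def blinfun.add_left blinfun.scaleR_left unit_star_e[OF vn])
    moreover have "root_fun x \<le> theta_fun p d v z"
    proof -
      have "\<bar>blinfun_apply x (\<theta> v)\<bar> \<le> norm x * norm (\<theta> v)"
        using norm_blinfun[of x "\<theta> v"] by simp
      also have "\<dots> \<le> norm x * 5" by (intro mult_left_mono norm_theta_le vn) simp
      also have "\<dots> \<le> 5 * norm x * 2 powr (k / p)"
        using mult_left_mono[of 1 "2 powr (k / p)" "5 * norm x"] p by (simp add: ge_one_powr_ge_zero)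
      finally have "\<bar>blinfun_apply x (\<theta> v)\<bar> \<le> 5 * norm x * 2 powr (k / p)" .
      hence "root_fun x / d * 2 powr (k / p) \<le> \<bar>blinfun_apply z (\<theta> v)\<bar>"
      proof -
        have "R \<le> \<bar>b\<bar>" if "\<bar>a\<bar> \<le> c" "b = a + (c + R)" for a b c R :: real
          using that by linarith
        from this[OF \<open>\<bar>blinfun_apply x (\<theta> v)\<bar> \<le> 5 * norm x * 2 powr (k / p)\<close>]
        show ?thesis
          unfolding z_def blinfun.add_left blinfun.scaleR_left unit_star_theta[OF vn] M_def
          by (simp add: distrib_right)
      qed
      hence "d * 2 powr (- (k / p)) * (root_fun x / d * 2 powr (k / p)) \<le> theta_fun p d v z"
        unfolding theta_fun_def fst using d by (simp only: minus_divide_left) (intro mult_left_mono, auto)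
      also have "d * 2 powr (- (k / p)) * (root_fun x / d * 2 powr (k / p)) = root_fun x"
        using d by (simp add: powr_minus)
      finally show ?thesis .
    qed
    ultimately show ?thesis by (simp add: z_def min_def)
  qed
  have "root_fun x - u x \<le> 0"
  proof (rule field_le_epsilon)
    fix \<delta> :: real assume \<delta>: "0 < \<delta>"
    \<comment> \<open>Collects \<open>norm x + 2 * M\<close> from the test vectors and another
      \<open>norm x\<close> from passing from \<open>w x\<close> to \<open>u x\<close>; the 1
      ensures positivity.\<close>
    define s where "s = 2 * norm x + 2 * M + 1"
    have s: "0 < s" using M by (simp add: s_def add_nonneg_pos)
    define \<epsilon> where "\<epsilon> = \<delta> / s"
    have eps: "0 < \<epsilon>" using \<delta> s by (simp add: \<epsilon>_def)
    then obtain w where w: "w \<in> FVL" "p_norm p (\<lambda>x. u x - w x) < ennreal \<epsilon>"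
      using u by (auto simp: Hp_closure_def)
    obtain F C where FC: "finite F" "0 \<le> C"
      "\<And>x'. \<bar>w x' - w x\<bar> \<le> C * (\<Sum>y\<in>F. \<bar>blinfun_apply x' y - blinfun_apply x y\<bar>)"
      using FVL_eval_lipschitz[OF w(1)] unfolding eval_lipschitz_def by blast
    have "root_fun x - w x \<le> \<epsilon> * (norm x + 2 * M)"
    proof (rule test_vector_bound[where u = u and w = w and x = x and K = 1])
      show "\<bar>w x' - w x\<bar> \<le> C * (\<Sum>y\<in>F. \<bar>blinfun_apply x' y - blinfun_apply x y\<bar>)" for x'
        by (rule FC(3))
      show "root_fun x \<le> u (x + (M * 2 powr (k / p)) *\<^sub>R unit_star v)"
        if "1 \<le> k" "v \<in> level k" for k v
        using that by (rule large)
      show "lp_norm p n (\<lambda>i. u (z i) - w (z i)) \<le> \<epsilon> * weak_lp_norm p n z" for n z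
        using p_norm_less_imp[OF _ w(2)] p by simp
    qed (use p FC(2) M eps in auto)
    moreover have "\<bar>u x - w x\<bar> \<le> \<epsilon> * norm x"
      using p_norm_less_imp_pointwise[OF _ w(2)] p eps by simp
    moreover have "\<epsilon> * (2 * norm x + 2 * M) \<le> \<epsilon> * s"
      using eps by (intro mult_left_mono) (auto simp: s_def)
    ultimately have "root_fun x - u x \<le> \<epsilon> * s" by (simp add: algebra_simps)
    thus "root_fun x - u x \<le> 0 + \<delta>" using s by (simp add: \<epsilon>_def)
  qed
  thus "root_fun x \<le> u x" by simp
qed

lemma mean_bounded_in_Hp_closure:
  assumes p: "1 < p" and d: "0 \<le> d" and A: "FVL \<subseteq> A" and f: "f \<in> mean_bounded p d"
  shows "f \<in> Hp_closure p A"
proof (rule subset_Hp_closure[OF p])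
  have fF: "f \<in> FVL" using f by (simp add: mean_bounded_def)
  thus "f \<in> A" using A by blast
  have "p_norm p f < \<infinity>"
    using p_norm_mean_bounded_le[OF p d f] by (rule order_le_less_trans) simp
  thus "f \<in> Hp_wstar p" using fF FVL_subset_H_wstar by (auto simp: Hp_wstar_def)
qed

text \<open>The directed set \<open>S\<close> has supremum \<open>root_fun\<close>, whose
  \<open>p\<close>-norm is detected by the root unit functional, while its members have norm at most
  \<open>5 * d\<close>.\<close>

theorem not_fatou_property_FBL:
  assumes p: "2 \<le> p" and lam: "0 < lam"
  shows "\<not> fatou_property (FBL TYPE('x) p) (p_norm p) lam"
proof
  assume fatou: "fatou_property (FBL TYPE('x) p) (p_norm p) lam"
  \<comment> \<open>Chosen so that \<open>lam * (5 * d) = 1 / 2\<close>.\<close>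
  define d where "d = 1 / (10 * lam)"
  have d: "0 < d" using lam by (simp add: d_def)
  have p1: "1 < p" using p by simp
  define S where "S = {f \<in> mean_bounded p d. f \<le> root_fun}"
  have "root_fun \<in> Hp_closure p FVL"
  proof (rule subset_Hp_closure[OF p1 root_fun_in_FVL])
    have "p_norm p root_fun < \<infinity>"
      using p_norm_abs_eval_at_le[OF p1, of "e root_node"] by (rule order_le_less_trans) simp
    thus "root_fun \<in> Hp_wstar p"
      using root_fun_in_FVL FVL_subset_H_wstar by (auto simp: Hp_wstar_def)
  qed
  hence sup: "is_supremum_in (FBL TYPE('x) p) S root_fun"
    using root_fun_le_upper_bound[OF p d] by (auto simp: is_supremum_in_def FBL_def S_def)
  have "inf root_fun (theta_fun p d root_node) \<in> S"
    unfolding S_def using p d root_fun_in_FVL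
    by (auto intro!: inf_mean_bounded theta_fun_mean_bounded simp: le_fun_def tree_nodes_def)
  moreover have "\<exists>h\<in>S. f \<le> h \<and> g \<le> h" if "f \<in> S" "g \<in> S" for f g
    using that p by (intro bexI[of _ "sup f g"]) (auto simp: S_def intro: mean_bounded_sup)
  ultimately have dir: "upward_directed S"
    unfolding upward_directed_def by blast
  have sub: "S \<subseteq> {f \<in> FBL TYPE('x) p. (\<lambda>_. 0) \<le> f}"
    using mean_bounded_in_Hp_closure[OF p1 less_imp_le[OF d] subset_refl]
    by (auto simp: S_def FBL_def mean_bounded_def)
  have "p_norm p root_fun \<le> ennreal lam * (SUP f\<in>S. p_norm p f)"
    using fatou sub dir sup unfolding fatou_property_def by blast
  also have "\<dots> \<le> ennreal lam * ennreal (5 * d)"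
    using p_norm_mean_bounded_le[OF p1 less_imp_le[OF d]]
    by (intro mult_left_mono SUP_least) (auto simp: S_def)
  also have "\<dots> = ennreal (1 / 2)"
    using lam by (simp add: d_def flip: ennreal_mult)
  \<comment> \<open>The pointwise estimate requires a strict bound on the norm; any number between
    1/2 and 1 would do.\<close>
  also have "\<dots> < ennreal (3 / 4)" by (rule ennreal_lessI) auto
  finally have "\<bar>root_fun (unit_star root_node)\<bar> \<le> 3 / 4 * norm (unit_star root_node)"
    by (intro p_norm_less_imp_pointwise[OF p1]) auto
  moreover have "root_fun (unit_star root_node) = 1"
    by (simp add: eval_at_def unit_star_e tree_nodes_def)
  moreover have "norm (unit_star root_node) \<le> 1"
    using norm_sum_unit_star_le[of "\<lambda>_. 1" 0] by (simp add: level_def)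
  ultimately show False by simp
qed

text \<open>The directed set \<open>mean_bounded p 1\<close> is its own index set. An upper bound
  would be close to a dominated \<open>w\<close>, which is almost 0 at test vectors where some
  \<open>theta_fun\<close> equals 1.\<close>

theorem not_monotonically_bounded_Ip_wstar:
  assumes p: "2 \<le> p"
  shows "\<not> monotonically_bounded (Ip_wstar TYPE('x) p) (p_norm p)"
proof
  assume mb: "monotonically_bounded (Ip_wstar TYPE('x) p) (p_norm p)"
  have p1: "1 < p" using p by simp
  let ?S = "mean_bounded p 1"
  let ?r = "{(f, g). f \<in> ?S \<and> g \<in> ?S \<and> f \<le> g}"
  have "?S \<noteq> {}"
    using theta_fun_mean_bounded[of p 1 root_node] p by (auto simp: tree_nodes_def)
  moreover have "preorder_on ?S ?r"
    by (auto simp: preorder_on_def refl_on_def intro!: transI)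
  moreover have "\<forall>f\<in>?S. \<forall>g\<in>?S. \<exists>h\<in>?S. (f, h) \<in> ?r \<and> (g, h) \<in> ?r"
  proof (intro ballI)
    fix f g assume "f \<in> ?S" "g \<in> ?S"
    thus "\<exists>h\<in>?S. (f, h) \<in> ?r \<and> (g, h) \<in> ?r"
      using mean_bounded_sup[of p f 1 g] p by (intro bexI[of _ "sup f g"]) auto
  qed
  moreover have "id ` ?S \<subseteq> {f \<in> Ip_wstar TYPE('x) p. (\<lambda>_. 0) \<le> f}"
    using mean_bounded_in_Hp_closure[OF p1 _ FVL_subset_I_wstar, of 1]
    by (auto simp: Ip_wstar_def mean_bounded_def)
  moreover have "\<exists>C::real. \<forall>f\<in>?S. p_norm p (id f) \<le> ennreal C"
    using p_norm_mean_bounded_le[OF p1, of 1] by (intro exI[of _ "5 * 1"]) auto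
  moreover have "\<forall>(f, g)\<in>?r. id f \<le> id g" by auto
  ultimately have "\<exists>u\<in>Ip_wstar TYPE('x) p. \<forall>f\<in>?S. id f \<le> u"
    using mb[unfolded monotonically_bounded_def, rule_format, of ?S ?r id] by blast
  then obtain u where u: "u \<in> Hp_closure p I_wstar" and ub: "\<And>f. f \<in> ?S \<Longrightarrow> f \<le> u"
    by (auto simp: Ip_wstar_def)
  \<comment> \<open>With base point 0 and \<open>M = 1\<close> this tolerance turns the test vector
    bound into \<open>1 \<le> 1 / 2\<close>.\<close>
  have "0 < (1 / 4 :: real)" by simp
  then obtain w where w: "w \<in> I_wstar" "p_norm p (\<lambda>x. u x - w x) < ennreal (1 / 4)"
    using u unfolding Hp_closure_def by blast
  obtain F C where FC: "finite F" "0 \<le> C" "\<And>x. \<bar>w x\<bar> \<le> C * (\<Sum>y\<in>F. \<bar>blinfun_apply x y\<bar>)"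
    using I_wstar_eval_dominated[OF w(1)] unfolding eval_dominated_def by blast
  have "1 - 0 \<le> 1 / 4 * (norm (0 :: 'x \<Rightarrow>\<^sub>L real) + 2 * 1)"
  \<comment> \<open>At base point 0 with \<open>b = 0\<close>, domination of \<open>w\<close> is
    exactly the required estimate, so the whole ideal is covered.\<close>
  proof (rule test_vector_bound[OF p FC(2)])
    show "\<bar>w x' - 0\<bar> \<le> C * (\<Sum>y\<in>F. \<bar>blinfun_apply x' y - blinfun_apply 0 y\<bar>)" for x'
      using FC(3) by simp
    show "lp_norm p n (\<lambda>i. u (z i) - w (z i)) \<le> 1 / 4 * weak_lp_norm p n z" for n z
      by (rule p_norm_less_imp[OF p1 w(2)])
    fix k v assume "0 \<le> k" and v: "v \<in> level k"
    have vn: "v \<in> tree_nodes" and fst: "fst v = k" using v level_subset by (auto simp: level_def)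
    have "theta_fun p 1 v (0 + (1 * 2 powr (k / p)) *\<^sub>R unit_star v) = 1"
      by (simp add: theta_fun_def fst blinfun.scaleR_left unit_star_theta[OF vn] powr_minus)
    thus "1 \<le> u (0 + (1 * 2 powr (k / p)) *\<^sub>R unit_star v)"
      using ub[OF theta_fun_mean_bounded[of p 1 v], THEN le_funD] vn p by (metis less_le_trans zero_le_one zero_less_numeral)
  qed auto
  thus False by simp
qed

end

section \<open>The two spaces\<close>

interpretation dual: jt_embedding "\<lambda>y. y" jt_coord
  by (rule jt_embedding.intro) (simp_all add: bounded_linear_ident)

text \<open>The locale asks for \<open>J_e\<close> at all pairs of numbers; outside the tree the
  coordinate functional is 0.\<close>

lemma jt_coord_in_predual: "jt_coord v \<in> closure (span (jt_coord ` tree_nodes))"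
proof (cases "v \<in> tree_nodes")
  case True
  hence "jt_coord v \<in> span (jt_coord ` tree_nodes)" by (intro span_base imageI)
  thus ?thesis using closure_subset by blast
next
  case False
  have "jt_apply a v = 0" for a
    using jt_apply[of a] False unfolding jt_families_def by blast
  hence "jt_coord v = 0" by (intro blinfun_eqI) (simp add: jt_coord.rep_eq)
  thus ?thesis using closure_subset span_zero by auto
qed

interpretation predual: jt_embedding jt_predual_functional "\<lambda>v. Abs_jt_predual (jt_coord v)"
proof
  show "jt_predual_functional (Abs_jt_predual (jt_coord v)) = jt_coord v" for v
    by (rule Abs_jt_predual_inverse[OF jt_coord_in_predual])
  show "norm (jt_predual_functional x) = norm x" for x
    by (simp add: norm_jt_predual.rep_eq)
  thus "\<exists>K. \<forall>x. norm (jt_predual_functional x) \<le> norm x * K"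
    by (intro exI[of _ 1]) simp
qed (simp_all add: plus_jt_predual.rep_eq scaleR_jt_predual.rep_eq)

theorem proposition7p1:
  fixes p :: real
  assumes "2 \<le> p"
  shows "(\<forall>lam>0. \<not> fatou_property (FBL TYPE(jt_predual) p) (p_norm p) lam) \<and>
    (\<forall>lam>0. \<not> fatou_property (FBL TYPE(jt \<Rightarrow>\<^sub>L real) p) (p_norm p) lam) \<and>
    \<not> monotonically_bounded (Ip_wstar TYPE(jt_predual) p) (p_norm p) \<and>
    \<not> monotonically_bounded (Ip_wstar TYPE(jt \<Rightarrow>\<^sub>L real) p) (p_norm p)"
  using assms dual.not_fatou_property_FBL predual.not_fatou_property_FBL
    dual.not_monotonically_bounded_Ip_wstar predual.not_monotonically_bounded_Ip_wstar
  by blast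

end
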